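(* Let $V$ be a Euclidean $7$-space identified with $\operatorname{Im}\mathbb O$, let $W=\mathbb O\otimes_{\mathbb R}V$, and let $h:W\to W$ be the real-linear operator $h(\hat w)=\big((\hat e_i\hat e_j)\hat w_j\big)\otimes e_i$ for $\hat w=\hat w_j\otimes e_j$. The real spectrum of $h$ is $$\operatorname{Spec}_{\mathbb R}(h)=\left\{-7,\,-4,\,0,\,\frac{1-\sqrt{33}}{2},\,\frac{1+\sqrt{33}}{2}\right\}.$$ More precisely, with respect to the decomposition $W\cong \mathbf 1\oplus\mathbf 7\oplus\mathbf 7\oplus\mathbf{14}\oplus\mathbf{27}$ into irreducible $G_2$-modules: (1) $-7$ occurs on $\mathbf 1$, with multiplicity $1$; (2) $-4$ occurs on $\mathbf{14}$, with multiplicity $14$; (3) $0$ occurs on $\mathbf{27}$, with multiplicity $27$; (4) the remaining two eigenvalues are the eigenvalues of $\begin{pmatrix}-1&6\\1&2\end{pmatrix}$ on the $\mathbf 7\oplus\mathbf 7$ isotypic component, each with multiplicity $7$.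
   Context: $\mathbb O$ is the octonion algebra with inner product $\langle x,y\rangle=\operatorname{Re}(x\bar y)$, and $\operatorname{Im}\mathbb O$ is its $7$-dimensional space of imaginary elements. $V$ is an oriented Euclidean $7$-dimensional real vector space with metric $g$ and a fixed isometric identification $V\cong\hat V:=\operatorname{Im}\mathbb O$, $v\mapsto\hat v$; only hatted vectors are multiplied in $\mathbb O$. $G_2=\operatorname{Aut}(\mathbb O)$ acts on $\operatorname{Im}\mathbb O$ and, via the identification, on $V$; it acts on $W=\mathbb O\otimes_{\mathbb R}V$ by $\gamma(x\otimes v)=\gamma(x)\otimes\gamma(v)$. The cross product and $3$-form are defined by $\hat u\hat v=-g(u,v)1+\hat u\times\hat v$ and $\varphi(u,v,w)=g(u\times v,w)$. Fix an orthonormal basis $e_1,\dots,e_7$ of $V$ with corresponding basis $\hat e_1,\dots,\hat e_7$ of $\hat V$; repeated indices are summed; so $\hat e_i\hat e_j=-g_{ij}1+\varphi_{ijk}\hat e_k$. The operator $h$ is independent of the choice of basis. Every element of $W$ can be written $\hat w=(v_j1+w_{ij}\hat e_i)\otimes e_j$ with $v_j,w_{ij}\in\mathbb R$. The $G_2$-summands are: $\mathbf 1$: $v=0$, $w_{ij}$ a multiple of $g_{ij}$; the first $\mathbf 7$: $w=0$, $v$ arbitrary; the second $\mathbf 7$ ($\Lambda^2_7V$): $v=0$, $w_{ij}=\varphi_{kij}u_k$ for $u\in V$; $\mathbf{14}$ ($\Lambda^2_{14}V$): $v=0$, $w$ skew with $\varphi_{ijp}w_{ij}=0$; $\mathbf{27}$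 ($S^2_0V$): $v=0$, $w$ symmetric and trace-free. The $2\times2$ matrix on $\mathbf 7\oplus\mathbf 7$ is with respect to the ordered parametrization $(v,u)\in V\oplus V\mapsto v_j1\otimes e_j+\varphi_{kij}u_k\hat e_i\otimes e_j$. *)

theory Defs
  imports "HOL-Analysis.Analysis"
begin

section \<open>The octonions\<close>

text \<open>The octonions are modelled on the space \<open>\<real> \<oplus> \<real>\<^sup>7\<close> (real part, imaginary part), whose library
  inner product is \<open>\<langle>x, y\<rangle> = Re (x * conj y)\<close>. Imaginary units are indexed by the integers modulo 7
  (the numeral type \<open>7\<close>, with modular arithmetic), and the multiplication table is the usual one:
  \<open>e\<^sub>k\<^sub>+\<^sub>1 e\<^sub>k\<^sub>+\<^sub>3 = e\<^sub>k\<close>, together with \<open>e\<^sub>k\<^sub>+\<^sub>2 e\<^sub>k\<^sub>+\<^sub>6 = e\<^sub>k\<close> and \<open>e\<^sub>k\<^sub>+\<^sub>4 e\<^sub>k\<^sub>+\<^sub>5 = e\<^sub>k\<close>, which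
  follow from it by cyclic permutation of each quaternionic triple.\<close>

type_synonym octonion = "real \<times> (real^7)"

definition im_cross :: "real^7 \<Rightarrow> real^7 \<Rightarrow> real^7" where
  "im_cross a b = (\<chi> k.
      (a $ (k+1) * b $ (k+3) - a $ (k+3) * b $ (k+1))
    + (a $ (k+2) * b $ (k+6) - a $ (k+6) * b $ (k+2))
    + (a $ (k+4) * b $ (k+5) - a $ (k+5) * b $ (k+4)))"

definition omult :: "octonion \<Rightarrow> octonion \<Rightarrow> octonion" (infixl "\<cdot>" 70) where
  "x \<cdot> y = (fst x * fst y - snd x \<bullet> snd y,
            fst x *\<^sub>R snd y + fst y *\<^sub>R snd x + im_cross (snd x) (snd y))"

definition oone :: octonion where "oone = (1, 0)"

definition ImO :: "octonion set" where "ImO = {x. fst x = 0}"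

text \<open>By Hurwitz' theorem, being an 8-dimensional unital real algebra with multiplicative Euclidean
  norm characterizes the octonions up to isomorphism.\<close>

lemma omult_oone [simp]: "oone \<cdot> x = x" "x \<cdot> oone = x"
  by (auto simp: omult_def oone_def im_cross_def prod_eq_iff vec_eq_iff)

lemma UNIV_7: "(UNIV :: 7 set) = {0, 1, 2, 3, 4, 5, 6}"
proof -
  have "card {0, 1, 2, 3, 4, 5, 6 :: 7} = CARD(7)" by simp
  then show ?thesis
    using card_subset_eq[of "UNIV :: 7 set" "{0, 1, 2, 3, 4, 5, 6}"] by simp
qed

lemma sum_7: "(\<Sum>i\<in>(UNIV :: 7 set). f i) = f 0 + f 1 + f 2 + f 3 + f 4 + f 5 + f 6"
  for f :: "7 \<Rightarrow> 'a::comm_monoid_add"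
  by (subst UNIV_7) (simp add: add.assoc)

lemma numerals_mod_7:
  "(7::7) = 0" "(8::7) = 1" "(9::7) = 2" "(10::7) = 3" "(11::7) = 4" "(12::7) = 5"
  by simp_all

lemma im_cross_orthogonal: "a \<bullet> im_cross a b = 0" "b \<bullet> im_cross a b = 0"
  by (simp_all add: im_cross_def inner_vec_def sum_7 numerals_mod_7 algebra_simps)

lemma im_cross_lagrange:
  "im_cross a b \<bullet> im_cross a b = (a \<bullet> a) * (b \<bullet> b) - (a \<bullet> b) * (a \<bullet> b)"
  by (simp add: im_cross_def inner_vec_def sum_7 numerals_mod_7 algebra_simps)

lemma norm_omult: "norm (x \<cdot> y) = norm x * norm y"
proof -
  obtain r a s b where xy: "x = (r, a)" "y = (s, b)"
    by (cases x, cases y)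
  have "im_cross a b \<bullet> a = 0" "im_cross a b \<bullet> b = 0"
    using im_cross_orthogonal by (simp_all only: inner_commute[of "im_cross a b"])
  then have "(x \<cdot> y) \<bullet> (x \<cdot> y) = (x \<bullet> x) * (y \<bullet> y)"
    unfolding xy omult_def
    by (simp add: inner_add_left inner_add_right im_cross_orthogonal im_cross_lagrange
        inner_commute[of b a] algebra_simps)
  then show ?thesis
    by (simp add: norm_eq_sqrt_inner real_sqrt_mult)
qed

text \<open>Preservation of the unit follows from surjectivity and multiplicativity.\<close>

definition G2 :: "(octonion \<Rightarrow> octonion) set" where
  "G2 = {\<gamma>. linear \<gamma> \<and> bij \<gamma> \<and> (\<forall>x y. \<gamma> (x \<cdot> y) = \<gamma> x \<cdot> \<gamma> y)}"

section \<open>Tensor products of real vector spaces\<close>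

text \<open>The universal property, tested on scalar-valued bilinear maps only. Since linear functionals
  separate points, this implies the universal property for arbitrary targets (next lemma).\<close>

definition is_tensor_product ::
  "('a::real_vector \<Rightarrow> 'b::real_vector \<Rightarrow> 'w::real_vector) \<Rightarrow> bool" where
  "is_tensor_product t \<longleftrightarrow> bilinear t \<and>
     (\<forall>\<beta> :: 'a \<Rightarrow> 'b \<Rightarrow> real. bilinear \<beta> \<longrightarrow> (\<exists>!f. linear f \<and> (\<forall>x v. f (t x v) = \<beta> x v)))"

lemma functional_nonzero:
  fixes d :: "'d::real_vector"
  assumes "d \<notin> span S"
  obtains \<psi> :: "'d \<Rightarrow> real" where "linear \<psi>" "\<psi> d = 1" "\<And>s. s \<in> S \<Longrightarrow> \<psi> s = 0"
proof -
  obtain C where C: "C \<subseteq> S" "independent C" "S \<subseteq> span C"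
    by (metis maximal_independent_subset)
  have "d \<notin> span C"
    using assms C(1) span_mono by blast
  then have "independent (insert d C)"
    using C(2) by (simp add: independent_insert)
  from linear_independent_extend[OF this, of "\<lambda>x. if x = d then 1 else 0 :: real"]
  obtain \<psi> :: "'d \<Rightarrow> real" where psi: "linear \<psi>" "\<And>x. x \<in> insert d C \<Longrightarrow> \<psi> x = (if x = d then 1 else 0)"
    by blast
  have "\<psi> x = 0" if "x \<in> C" for x
    using psi(2)[of x] that \<open>d \<notin> span C\<close> span_base by (auto split: if_splits)
  then have "\<psi> s = 0" if "s \<in> span C" for s
    using linear_eq_0_on_span[OF psi(1)] that by blast
  with psi C(3) that show thesis by (simp add: subset_iff)
qed

lemma is_tensor_product_span:
  assumes t: "is_tensor_product t"
  shows "span (range (case_prod t)) = UNIV"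
proof (rule ccontr)
  assume "span (range (case_prod t)) \<noteq> UNIV"
  then obtain d where d: "d \<notin> span (range (case_prod t))" by blast
  obtain \<psi> where psi: "linear \<psi>" "\<psi> d = (1::real)" "\<And>s. s \<in> range (case_prod t) \<Longrightarrow> \<psi> s = 0"
    using functional_nonzero[OF d] by metis
  have 0: "\<psi> (t x v) = 0" for x v
    by (rule psi(3)) (metis case_prod_conv rangeI)
  have "bilinear (\<lambda>_ _. 0 :: real)"
    by (simp add: bilinear_def linear_iff)
  then have "\<exists>!f. linear f \<and> (\<forall>x v. f (t x v) = (0::real))"
    using t unfolding is_tensor_product_def by blast
  then have "\<psi> = (\<lambda>_. 0)"
    using psi(1) 0 linear_zero by blast
  with psi(2) show False by simp
qed

lemma is_tensor_product_lift:
  fixes B :: "'a::real_vector \<Rightarrow> 'b::real_vector \<Rightarrow> 'd::real_vector"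
  assumes t: "is_tensor_product t" and B: "bilinear B"
  shows "\<exists>!L. linear L \<and> (\<forall>x v. L (t x v) = B x v)"
proof -
  note sp = is_tensor_product_span[OF t]
  obtain C where C: "C \<subseteq> range (case_prod t)" "independent C" "range (case_prod t) \<subseteq> span C"
    by (metis maximal_independent_subset)
  have spC: "span C = UNIV"
    using C(3) sp by (metis UNIV_eq_I span_minimal subspace_span subset_UNIV top.extremum_uniqueI)
  have "\<forall>c\<in>C. \<exists>p. c = case_prod t p"
    using C(1) by (auto simp del: split_paired_Ex)
  then obtain p where p: "\<And>c. c \<in> C \<Longrightarrow> c = case_prod t (p c)" by metis
  obtain L where L: "linear L" "\<And>c. c \<in> C \<Longrightarrow> L c = case_prod B (p c)"
    using linear_independent_extend[OF C(2), of "\<lambda>c. case_prod B (p c)"] by blast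
  have "L (t x v) = B x v" for x v
  proof (rule ccontr)
    assume "L (t x v) \<noteq> B x v"
    then have "L (t x v) - B x v \<notin> span {}" by simp
    then obtain \<psi> where psi: "linear \<psi>" "\<psi> (L (t x v) - B x v) = (1::real)"
      using functional_nonzero by metis
    have "bilinear (\<lambda>x v. \<psi> (B x v))"
      unfolding bilinear_def
    proof (intro conjI allI)
      fix x v
      show "linear (\<lambda>v. \<psi> (B x v))"
        using linear_compose[OF _ psi(1), of "B x"] B by (simp add: bilinear_def o_def)
      show "linear (\<lambda>x. \<psi> (B x v))"
        using linear_compose[OF _ psi(1), of "\<lambda>x. B x v"] B by (simp add: bilinear_def o_def)
    qed
    then obtain f where f: "linear f" "\<And>x v. f (t x v) = \<psi> (B x v)"
      using t unfolding is_tensor_product_def by blast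
    have "f c = \<psi> (L c)" if "c \<in> C" for c
      using f(2)[of "fst (p c)" "snd (p c)"] L(2)[OF that] p[OF that]
      by (simp add: case_prod_beta)
    then have "f (t x v) = (\<psi> \<circ> L) (t x v)"
      using linear_eq_on_span[OF f(1) linear_compose[OF L(1) psi(1)], of C] spC by auto
    then show False
      using f(2)[of x v] psi by (simp add: linear_diff)
  qed
  moreover have "L1 = L2"
    if "linear L1 \<and> (\<forall>x v. L1 (t x v) = B x v)" "linear L2 \<and> (\<forall>x v. L2 (t x v) = B x v)" for L1 L2
  proof
    fix w
    show "L1 w = L2 w"
    proof (rule linear_eq_on_span[of L1 L2 "range (case_prod t)" w])
      show "L1 s = L2 s" if "s \<in> range (case_prod t)" for s
        using that \<open>linear L1 \<and> _\<close> \<open>linear L2 \<and> _\<close> by force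
    qed (use that sp in auto)
  qed
  ultimately show ?thesis using L(1) by blast
qed

lemma is_tensor_product_vec:
  "is_tensor_product (\<lambda>(x::'a::real_vector) (v::real^'n). (\<chi> j. v $ j *\<^sub>R x))"
    (is "is_tensor_product ?t")
proof -
  have bil: "bilinear ?t"
    by (simp add: bilinear_def linear_iff vec_eq_iff algebra_simps)
  have ax: "w = (\<Sum>j\<in>UNIV. ?t (w $ j) (axis j 1))" for w :: "'a^'n"
  proof -
    have "(\<Sum>j\<in>UNIV. axis j 1 $ i *\<^sub>R w $ j) = (\<Sum>j\<in>UNIV. if j = i then w $ j else 0)" for i
      by (rule sum.cong) (auto simp: axis_def)
    then show ?thesis by (simp add: vec_eq_iff)
  qed
  have "\<exists>!f. linear f \<and> (\<forall>x v. f (?t x v) = \<beta> x v)"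
    if b: "bilinear \<beta>" for \<beta> :: "'a \<Rightarrow> real^'n \<Rightarrow> real"
  proof (rule ex1I)
    let ?f = "\<lambda>w :: 'a^'n. \<Sum>j\<in>UNIV. \<beta> (w $ j) (axis j 1)"
    have lx: "linear (\<lambda>x. \<beta> x v)" and lv: "linear (\<beta> x)" for x v
      using b by (auto simp: bilinear_def)
    have val: "\<beta> x v = ?f (?t x v)" for x v
    proof -
      have "v = (\<Sum>j\<in>UNIV. v $ j *\<^sub>R axis j 1)"
        using basis_expansion[of v] by (simp add: scalar_mult_eq_scaleR)
      then have "\<beta> x v = \<beta> x (\<Sum>j\<in>UNIV. v $ j *\<^sub>R axis j 1)"
        by (rule arg_cong)
      also have "\<dots> = (\<Sum>j\<in>UNIV. v $ j *\<^sub>R \<beta> x (axis j 1))"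
        by (simp only: linear_sum[OF lv] linear_scale[OF lv])
      finally show ?thesis by (simp only: linear_scale[OF lx] vec_lambda_beta)
    qed
    have lin: "linear ?f"
    proof (intro linear_compose_sum ballI)
      fix j :: 'n
      have "linear (\<lambda>w :: 'a^'n. w $ j)" by (simp add: linear_iff)
      from linear_compose[OF this lx[of "axis j 1"]]
      show "linear (\<lambda>w. \<beta> (w $ j) (axis j 1))" by (simp add: o_def)
    qed
    show "linear ?f \<and> (\<forall>x v. ?f (?t x v) = \<beta> x v)"
      by (intro conjI allI lin val[symmetric])
    fix f assume f: "linear f \<and> (\<forall>x v. f (?t x v) = \<beta> x v)"
    show "f = ?f"
    proof
      fix w
      have "f w = f (\<Sum>j\<in>UNIV. ?t (w $ j) (axis j 1))"
        by (rule arg_cong[OF ax])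
      also have "\<dots> = (\<Sum>j\<in>UNIV. f (?t (w $ j) (axis j 1)))"
        by (rule linear_sum) (use f in blast)
      also have "\<dots> = ?f w"
        by (rule sum.cong) (use f in blast)+
      finally show "f w = ?f w" .
    qed
  qed
  with bil show ?thesis by (simp add: is_tensor_product_def)
qed

definition tensor_map ::
  "('a::real_vector \<Rightarrow> 'b::real_vector \<Rightarrow> 'w::real_vector) \<Rightarrow> ('a \<Rightarrow> 'a) \<Rightarrow> ('b \<Rightarrow> 'b) \<Rightarrow> 'w \<Rightarrow> 'w" where
  "tensor_map t p q = (THE F. linear F \<and> (\<forall>x v. F (t x v) = t (p x) (q v)))"

section \<open>Linear algebra\<close>

definition eigenspace :: "('w::real_vector \<Rightarrow> 'w) \<Rightarrow> real \<Rightarrow> 'w set" where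
  "eigenspace f c = {w. f w = c *\<^sub>R w}"

definition real_spectrum :: "('w::real_vector \<Rightarrow> 'w) \<Rightarrow> real set" where
  "real_spectrum f = {c. \<exists>w. w \<noteq> 0 \<and> f w = c *\<^sub>R w}"

definition direct_sum_decomposition :: "'w::real_vector set list \<Rightarrow> bool" where
  "direct_sum_decomposition Us \<longleftrightarrow> (\<forall>U\<in>set Us. subspace U) \<and>
     (\<forall>w. \<exists>!ws. list_all2 (\<in>) ws Us \<and> w = sum_list ws)"

section \<open>The \<open>G\<^sub>2\<close>-modules \<open>V\<close> and \<open>W = \<O> \<otimes> V\<close>\<close>

text \<open>Throughout, \<open>hat\<close> is the identification of \<open>V\<close> with \<open>ImO\<close>, \<open>e\<close> an orthonormal basis of \<open>V\<close>,
  and \<open>t x v\<close> stands for \<open>x \<otimes> v\<close>.\<close>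

definition isometric_identification :: "('v::euclidean_space \<Rightarrow> octonion) \<Rightarrow> bool" where
  "isometric_identification hat \<longleftrightarrow>
     linear hat \<and> (\<forall>u v. hat u \<bullet> hat v = u \<bullet> v) \<and> range hat = ImO"

definition orthonormal_basis :: "(7 \<Rightarrow> 'v::euclidean_space) \<Rightarrow> bool" where
  "orthonormal_basis e \<longleftrightarrow> (\<forall>i j. e i \<bullet> e j = (if i = j then 1 else 0)) \<and> span (range e) = UNIV"

definition act_V :: "('v::euclidean_space \<Rightarrow> octonion) \<Rightarrow> (octonion \<Rightarrow> octonion) \<Rightarrow> 'v \<Rightarrow> 'v" where
  "act_V hat \<gamma> v = inv hat (\<gamma> (hat v))"

definition act_W :: "('v::euclidean_space \<Rightarrow> octonion) \<Rightarrow> (octonion \<Rightarrow> 'v \<Rightarrow> 'w::real_vector) \<Rightarrow>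
    (octonion \<Rightarrow> octonion) \<Rightarrow> 'w \<Rightarrow> 'w" where
  "act_W hat t \<gamma> = tensor_map t \<gamma> (act_V hat \<gamma>)"

definition G2_submodule :: "('v::euclidean_space \<Rightarrow> octonion) \<Rightarrow>
    (octonion \<Rightarrow> 'v \<Rightarrow> 'w::real_vector) \<Rightarrow> 'w set \<Rightarrow> bool" where
  "G2_submodule hat t U \<longleftrightarrow> subspace U \<and> (\<forall>\<gamma>\<in>G2. act_W hat t \<gamma> ` U \<subseteq> U)"

definition G2_irreducible :: "('v::euclidean_space \<Rightarrow> octonion) \<Rightarrow>
    (octonion \<Rightarrow> 'v \<Rightarrow> 'w::real_vector) \<Rightarrow> 'w set \<Rightarrow> bool" where
  "G2_irreducible hat t U \<longleftrightarrow> G2_submodule hat t U \<and> U \<noteq> {0} \<and>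
     (\<forall>S. S \<subseteq> U \<and> G2_submodule hat t S \<longrightarrow> S = {0} \<or> S = U)"

text \<open>The sum of all submodules of \<open>W\<close> that are isomorphic to the \<open>G\<^sub>2\<close>-module \<open>V\<close>.\<close>

definition isotypic_component_7 :: "('v::euclidean_space \<Rightarrow> octonion) \<Rightarrow>
    (octonion \<Rightarrow> 'v \<Rightarrow> 'w::real_vector) \<Rightarrow> 'w set" where
  "isotypic_component_7 hat t = span (\<Union>{range T | T. linear T \<and> inj T \<and>
     (\<forall>\<gamma>\<in>G2. \<forall>v. T (act_V hat \<gamma> v) = act_W hat t \<gamma> (T v))})"

definition cross :: "('v::euclidean_space \<Rightarrow> octonion) \<Rightarrow> 'v \<Rightarrow> 'v \<Rightarrow> 'v" where
  "cross hat u v = inv hat (hat u \<cdot> hat v + (u \<bullet> v) *\<^sub>R oone)"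

definition phi :: "('v::euclidean_space \<Rightarrow> octonion) \<Rightarrow> 'v \<Rightarrow> 'v \<Rightarrow> 'v \<Rightarrow> real" where
  "phi hat u v w = cross hat u v \<bullet> w"

text \<open>The element \<open>(v\<^sub>j 1 + w\<^sub>i\<^sub>j hat e\<^sub>i) \<otimes> e\<^sub>j\<close> with coordinates \<open>v\<^sub>j\<close>, \<open>w\<^sub>i\<^sub>j\<close>.\<close>

definition elem_W :: "('v::euclidean_space \<Rightarrow> octonion) \<Rightarrow> (7 \<Rightarrow> 'v) \<Rightarrow>
    (octonion \<Rightarrow> 'v \<Rightarrow> 'w::real_vector) \<Rightarrow> (7 \<Rightarrow> real) \<Rightarrow> (7 \<Rightarrow> 7 \<Rightarrow> real) \<Rightarrow> 'w" where
  "elem_W hat e t v w =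
     (\<Sum>j\<in>UNIV. t (v j *\<^sub>R oone + (\<Sum>i\<in>UNIV. w i j *\<^sub>R hat (e i))) (e j))"

definition W1 where
  "W1 hat e t = {elem_W hat e t (\<lambda>_. 0) (\<lambda>i j. c * (e i \<bullet> e j)) | c. True}"

definition W7 where
  "W7 hat e t = {elem_W hat e t v (\<lambda>_ _. 0) | v. True}"

definition W7' where
  "W7' hat e t =
     {elem_W hat e t (\<lambda>_. 0) (\<lambda>i j. \<Sum>k\<in>UNIV. phi hat (e k) (e i) (e j) * u k) | u. True}"

definition W14 where
  "W14 hat e t = {elem_W hat e t (\<lambda>_. 0) w | w. (\<forall>i j. w j i = - w i j) \<and>
     (\<forall>p. (\<Sum>i\<in>UNIV. \<Sum>j\<in>UNIV. phi hat (e i) (e j) (e p) * w i j) = 0)}"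

definition W27 where
  "W27 hat e t = {elem_W hat e t (\<lambda>_. 0) w | w. (\<forall>i j. w j i = w i j) \<and> (\<Sum>i\<in>UNIV. w i i) = 0}"

text \<open>The parametrization of \<open>\<^bold>7 \<oplus> \<^bold>7\<close> by \<open>V \<oplus> V\<close>.\<close>

definition param_7_7 :: "('v::euclidean_space \<Rightarrow> octonion) \<Rightarrow> (7 \<Rightarrow> 'v) \<Rightarrow>
    (octonion \<Rightarrow> 'v \<Rightarrow> 'w::real_vector) \<Rightarrow> 'v \<Rightarrow> 'v \<Rightarrow> 'w" where
  "param_7_7 hat e t v u = elem_W hat e t (\<lambda>j. v \<bullet> e j)
     (\<lambda>i j. \<Sum>k\<in>UNIV. phi hat (e k) (e i) (e j) * (u \<bullet> e k))"

definition M77 :: "real^2^2" where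
  "M77 = vector [vector [-1, 6], vector [1, 2]]"

end

theory Submission
  imports Defs
begin

text \<open>
  In the standard basis an element of \<open>W\<close> is a pair \<open>(v, A)\<close> of a vector and a matrix, standing for
  \<open>\<Sum>j. (v\<^sub>j 1 + \<Sum>i. A\<^sub>i\<^sub>j e\<^sub>i) \<otimes> e\<^sub>j\<close>, and an automorphism \<open>\<gamma>\<close> acts by \<open>(v, A) \<mapsto> (g v, g A g\<^sup>T)\<close>, where \<open>g\<close> is the
  matrix of \<open>\<gamma>\<close> on the imaginary octonions. These \<open>g\<close> are exactly the orthogonal matrices that preserve
  the cross product (\<open>G2_obtain_matrix\<close>, \<open>G2_of_mem\<close>). Because \<open>\<Sum>j. B f\<^sub>j f\<^sub>j\<close> does not depend on the
  orthonormal basis \<open>f\<close> when \<open>B\<close> is bilinear (\<open>orthogonal_sum_bilinear\<close>), the operator \<open>h\<close> and the five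
  summands may be computed in the standard basis, whatever the basis \<open>e\<close> is.

  Write \<open>X(u)\<close> for the matrix of \<open>x \<mapsto> x \<times> u\<close> and \<open>\<kappa>(A)\<close> for the contraction of \<open>A\<close> with the 3-form. Then
  \<open>h\<close> is \<open>(v, A) \<mapsto> (\<kappa>(A) - v, X(v + \<kappa>(A)) - 2 (A - A\<^sup>T) - tr(A) I)\<close>. Every matrix is
  \<open>A = c I + X(u) + S + Y\<close> with \<open>S\<close> in the 14-dimensional and \<open>Y\<close> in the 27-dimensional summand, and
  \<open>tr(A) = 7 c\<close>, \<open>\<kappa>(A) = 6 u\<close>, \<open>A - A\<^sup>T = 2 X(u) + 2 S\<close>. This proves the decomposition, and it shows that
  \<open>h\<close> multiplies \<open>c\<close>, \<open>S\<close>, \<open>Y\<close> by \<open>-7\<close>, \<open>-4\<close>, \<open>0\<close> and sends \<open>(v, u)\<close> to \<open>(- v + 6 u, v + 2 u)\<close>. The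
  characteristic polynomial \<open>l\<^sup>2 - l - 8\<close> of the last map does not vanish at \<open>-7\<close>, \<open>-4\<close>, \<open>0\<close>, so the
  eigenspaces can be read off.

  Irreducibility needs only a few explicit automorphisms: the shifts \<open>e\<^sub>i \<mapsto> e\<^sub>i\<^sub>-\<^sub>m\<close> of the indices, the
  map induced by doubling the indices, the sign changes off a line of the Fano plane, and one family of rotations
  fixing \<open>e\<^sub>0\<close>. The sign changes and the identity form an elementary abelian group of order 8. Projections to its
  weight spaces are averages of group elements, so a submodule contains the weight components of each of
  its elements; the seven nontrivial weights are permuted transitively by the shifts. It therefore
  suffices to look at the weight of \<open>e\<^sub>0\<close>, and for the last summand also at the diagonal matrices, which
  carry the trivial weight:
  \<^item> in both 7-dimensional summands this weight space is a line;
  \<^item> in the 14-dimensional one it is the plane \<open>a + b + c = 0\<close>, the doubling permutes the coordinates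
    cyclically, and a plane rotated by a third of a turn has no invariant line;
  \<^item> in the 27-dimensional one it is a 3-space with coordinates \<open>a, b, c\<close>, which a rotation by a quarter
    turn and the doubling break up into single coordinates; an oblique rotation then connects these with
    the diagonal matrices.

  An equivariant image of \<open>e\<^sub>0\<close> in \<open>W\<close> has the same weight and the same symmetries as \<open>e\<^sub>0\<close>, which forces it
  into the span of \<open>(e\<^sub>0, 0)\<close> and \<open>(0, X(e\<^sub>0))\<close>. This identifies the isotypic component
  (\<open>equivariant_in_coords_77\<close>).
\<close>

section \<open>The cross product and the operator in coordinates\<close>

lemma forall_7: "(\<forall>i::7. P i) \<longleftrightarrow> P 0 \<and> P 1 \<and> P 2 \<and> P 3 \<and> P 4 \<and> P 5 \<and> P 6"
  by (metis UNIV_7 UNIV_I insertE singletonD)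

text \<open>The pair \<open>(v, A)\<close> collects the coordinates \<open>v\<^sub>j\<close> and \<open>w\<^sub>i\<^sub>j = A $ i $ j\<close>.\<close>

type_synonym coords = "(real^7) \<times> (real^7^7)"

text \<open>The entries are \<open>\<phi>(u, e\<^sub>i, e\<^sub>j)\<close>, so these matrices make up the second 7-dimensional summand.\<close>

definition cross_matrix :: "real^7 \<Rightarrow> real^7^7" where
  "cross_matrix u = (\<chi> i j. im_cross u (axis i 1) $ j)"

text \<open>The vector with components \<open>\<Sum>i j. \<phi>(e\<^sub>i, e\<^sub>j, e\<^sub>k) A\<^sub>i\<^sub>j\<close>, that is, the linear extension of the cross
  product from matrices \<open>a b\<^sup>T\<close> to all matrices.\<close>

definition contraction :: "real^7^7 \<Rightarrow> real^7" where
  "contraction A = (\<chi> k.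
      (A $ (k+1) $ (k+3) - A $ (k+3) $ (k+1))
    + (A $ (k+2) $ (k+6) - A $ (k+6) $ (k+2))
    + (A $ (k+4) $ (k+5) - A $ (k+5) $ (k+4)))"

definition mat_act :: "real^7^7 \<Rightarrow> coords \<Rightarrow> coords" where
  "mat_act g m = (g *v fst m, g ** snd m ** transpose g)"

text \<open>The matrices, on the imaginary octonions, of the automorphisms of the octonions.\<close>

definition G2_matrices :: "(real^7^7) set" where
  "G2_matrices = {g. orthogonal_matrix g \<and>
     (\<forall>x y. im_cross (g *v x) (g *v y) = g *v im_cross x y)}"

lemma cross_matrix_mult: "cross_matrix u *v x = im_cross x u"
  unfolding vec_eq_iff forall_7
  by (simp add: cross_matrix_def im_cross_def matrix_vector_mult_def sum_7 axis_def numerals_mod_7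
      algebra_simps)

lemma contraction_cross_matrix: "contraction (cross_matrix u) = 6 *\<^sub>R u"
  unfolding vec_eq_iff forall_7
  by (simp add: cross_matrix_def im_cross_def contraction_def axis_def numerals_mod_7
      algebra_simps)

text \<open>In this form the contraction is a sum over the standard basis of a bilinear expression, so that the basis
  can be exchanged for any other orthonormal one.\<close>

lemma contraction_alt: "contraction A = (\<Sum>j\<in>UNIV. im_cross (A *v axis j 1) (axis j 1))"
  unfolding vec_eq_iff forall_7 matrix_vector_mult_basis
  by (simp add: column_def im_cross_def contraction_def axis_def numerals_mod_7 sum_7
      algebra_simps)

text \<open>The coordinate form of \<open>h\<close>; the formula comes from \<open>h_coords_column\<close>.\<close>

definition h_coords :: "coords \<Rightarrow> coords" where
  "h_coords m = (contraction (snd m) - fst m,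
     cross_matrix (fst m + contraction (snd m)) - 2 *\<^sub>R (snd m - transpose (snd m)) - trace (snd m) *\<^sub>R mat 1)"

text \<open>The imaginary part of the double product in \<open>h\<close>. Both sides are linear in \<open>A\<close>, so the identity amounts to
  a finite verification on the multiplication table, one matrix entry at a time.\<close>

lemma im_cross_triple:
  "(\<Sum>j\<in>UNIV. im_cross (im_cross (axis i 1) (axis j 1)) (column j A))
     = column i (cross_matrix (contraction A) - 2 *\<^sub>R (A - transpose A) - trace A *\<^sub>R mat 1 + A)"
proof -
  have "\<forall>i k. (\<Sum>j\<in>UNIV. im_cross (im_cross (axis i 1) (axis j 1)) (column j A)) $ k
     = (cross_matrix (contraction A) - 2 *\<^sub>R (A - transpose A) - trace A *\<^sub>R mat 1 + A) $ k $ i"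
    unfolding forall_7
    by (intro conjI; simp add: sum_7 column_def im_cross_def cross_matrix_def
       contraction_def axis_def numerals_mod_7 transpose_def trace_def mat_def)
  then show ?thesis by (simp add: vec_eq_iff column_def)
qed

lemma im_cross_inner_column:
  "(\<Sum>j\<in>UNIV. im_cross (axis i 1) (axis j 1) \<bullet> column j A) = - contraction A $ i"
proof -
  have "\<forall>i. (\<Sum>j\<in>UNIV. im_cross (axis i 1) (axis j 1) \<bullet> column j A) = - contraction A $ i"
    unfolding forall_7
    by (intro conjI; simp add: sum_7 column_def im_cross_def inner_vec_def
       contraction_def axis_def numerals_mod_7)
  then show ?thesis by blast
qed

lemma im_cross_bilinear: "bilinear im_cross"
  unfolding bilinear_def linear_iff
  by (simp add: im_cross_def vec_eq_iff algebra_simps)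

lemma im_cross_axis_left: "im_cross (axis i 1) v $ k = cross_matrix v $ k $ i"
  using cross_matrix_mult[of v "axis i 1"] unfolding matrix_vector_mult_basis
  by (simp add: column_def vec_eq_iff)

text \<open>Expanding \<open>(e\<^sub>i e\<^sub>j)(v\<^sub>j + a\<^sub>j)\<close> with \<open>a\<^sub>j\<close> the \<open>j\<close>-th column of \<open>A\<close> and \<open>e\<^sub>i e\<^sub>j = - \<delta>\<^sub>i\<^sub>j + e\<^sub>i \<times> e\<^sub>j\<close>, the sum over \<open>j\<close> of
  the real parts gives \<open>- v\<^sub>i\<close> and a contraction, and that of the imaginary parts \<open>- a\<^sub>i\<close>, a cross product with \<open>v\<close> and
  the double cross product above.\<close>

lemma h_coords_column:
  "(\<Sum>j\<in>UNIV. ((0, axis i 1) \<cdot> (0, axis j 1)) \<cdot> (v $ j, column j A))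
     = (fst (h_coords (v,A)) $ i, column i (snd (h_coords (v,A))))" (is "?L = ?R") for i :: 7
proof -
  let ?e = "\<lambda>j::7. axis j 1 :: real^7"
  have eq: "((0, axis i 1) \<cdot> (0, axis j 1)) \<cdot> (v $ j, column j A)
    = ((if j = i then - (v $ i) else 0) - im_cross (?e i) (?e j) \<bullet> column j A,
       (if j = i then - column i A else 0) + im_cross (?e i) (v $ j *\<^sub>R ?e j)
         + im_cross (im_cross (?e i) (?e j)) (column j A))" for j
    by (cases "j = i") (simp_all add: omult_def inner_axis_axis bilinear_rmul[OF im_cross_bilinear])
  have v: "(\<Sum>j\<in>UNIV. v $ j *\<^sub>R ?e j) = v"
    using basis_expansion[of v] by (simp add: scalar_mult_eq_scaleR)
  have lin: "linear (im_cross (?e i))"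
    using im_cross_bilinear by (simp add: bilinear_def)
  have "fst ?L = - (v $ i) + contraction A $ i"
    unfolding eq fst_sum by (simp add: sum_subtractf im_cross_inner_column)
  moreover have "snd ?L = - column i A + im_cross (?e i) v
      + (\<Sum>j\<in>UNIV. im_cross (im_cross (?e i) (?e j)) (column j A))"
    unfolding eq snd_sum using linear_sum[OF lin, of "\<lambda>j. v $ j *\<^sub>R ?e j" UNIV]
    by (simp add: sum.distrib v)
  moreover have "cross_matrix (v + contraction A) = cross_matrix v + cross_matrix (contraction A)"
    using im_cross_bilinear by (simp add: cross_matrix_def bilinear_def vec_eq_iff linear_iff)
  ultimately show ?thesis
    unfolding im_cross_triple
    by (simp add: prod_eq_iff vec_eq_iff h_coords_def column_def im_cross_axis_left)
qed

section \<open>Orthonormal bases and matrices of automorphisms\<close>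

text \<open>Expanding the columns of \<open>F\<close> in the standard basis, the coefficient of \<open>B e\<^sub>a e\<^sub>b\<close> is the entry \<open>(a, b)\<close> of
  \<open>F F\<^sup>T = I\<close>. This is the source of all independence of the choice of an orthonormal basis.\<close>

lemma orthogonal_sum_bilinear:
  fixes B :: "real^'n \<Rightarrow> real^'n \<Rightarrow> 'z::real_vector"
  assumes B: "bilinear B" and F: "orthogonal_matrix F"
  shows "(\<Sum>j\<in>UNIV. B (F *v axis j 1) (F *v axis j 1)) = (\<Sum>j\<in>UNIV. B (axis j 1) (axis j 1))"
proof -
  have col: "F *v axis j 1 = (\<Sum>a\<in>UNIV. F$a$j *\<^sub>R axis a 1)" for j
    using basis_expansion[of "column j F"]
    by (simp add: matrix_vector_mult_basis scalar_mult_eq_scaleR column_def)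
  have l1: "linear (\<lambda>x. B x y)" and l2: "linear (B x)" for x y
    using B by (auto simp: bilinear_def)
  have exp: "B (F *v axis j 1) (F *v axis j 1)
      = (\<Sum>a\<in>UNIV. \<Sum>b\<in>UNIV. (F$a$j * F$b$j) *\<^sub>R B (axis a 1) (axis b 1))" for j
    unfolding col linear_sum[OF l1] linear_sum[OF l2] linear_scale[OF l1] linear_scale[OF l2]
    by (subst sum.swap) (simp add: scaleR_sum_right mult.commute)
  have dot: "(\<Sum>j\<in>UNIV. F$a$j * F$b$j) = (if a = b then 1 else 0)" for a b
    using F unfolding orthogonal_matrix_def
    by (simp add: vec_eq_iff matrix_matrix_mult_def transpose_def mat_def)
  have "(\<Sum>j\<in>UNIV. B (F *v axis j 1) (F *v axis j 1))
      = (\<Sum>a\<in>UNIV. \<Sum>b\<in>UNIV. \<Sum>j\<in>UNIV. (F$a$j * F$b$j) *\<^sub>R B (axis a 1) (axis b 1))"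
    unfolding exp by (subst sum.swap, rule sum.cong[OF refl], rule sum.swap)
  also have "\<dots> = (\<Sum>a\<in>UNIV. \<Sum>b\<in>UNIV. (if a = b then 1 else 0) *\<^sub>R B (axis a 1) (axis b 1))"
    by (simp only: scaleR_sum_left[symmetric] dot)
  also have "\<dots> = (\<Sum>a\<in>UNIV. B (axis a 1) (axis a 1))"
    by (simp add: if_distrib[of "\<lambda>r. r *\<^sub>R _"] cong: if_cong)
  finally show ?thesis .
qed

lemma G2_matricesD:
  assumes "g \<in> G2_matrices"
  shows "orthogonal_matrix g" "im_cross (g *v x) (g *v y) = g *v im_cross x y"
    "transpose g ** g = mat 1" "g ** transpose g = mat 1" "transpose g *v (g *v x) = x"
    "g *v (transpose g *v x) = x"
  using assms by (auto simp: G2_matrices_def orthogonal_matrix_def matrix_vector_mul_assoc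
      simp del: transpose_matrix_vector)

lemma linear_mat_act: "linear (mat_act g)"
  unfolding mat_act_def linear_iff
  by (auto simp: matrix_vector_right_distrib matrix_vector_mult_scaleR vec_eq_iff matrix_matrix_mult_def
      algebra_simps sum.distrib sum_distrib_left sum_distrib_right)

lemma linear_cross_matrix: "linear cross_matrix"
  using im_cross_bilinear by (simp add: cross_matrix_def bilinear_def vec_eq_iff linear_iff)

lemma linear_contraction: "linear contraction"
  by (simp add: contraction_def vec_eq_iff linear_iff algebra_simps)

lemma cross_matrix_equivariant:
  assumes g: "g \<in> G2_matrices"
  shows "g ** cross_matrix u ** transpose g = cross_matrix (g *v u)"
proof -
  have "g *v (cross_matrix u *v (transpose g *v x)) = cross_matrix (g *v u) *v x" for x
    using G2_matricesD(2)[OF g, of "transpose g *v x" u] by (simp add: cross_matrix_mult G2_matricesD(6)[OF g] del: transpose_matrix_vector)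
  then show ?thesis
    by (simp add: matrix_eq matrix_vector_mul_assoc[symmetric] del: transpose_matrix_vector)
qed

text \<open>Evaluate the contraction in the orthonormal basis \<open>g e\<^sub>j\<close> instead of \<open>e\<^sub>j\<close>.\<close>

lemma contraction_equivariant:
  assumes g: "g \<in> G2_matrices"
  shows "contraction (g ** A ** transpose g) = g *v contraction A"
proof -
  let ?B = "\<lambda>x y. im_cross ((g ** A ** transpose g) *v x) y"
  have "bilinear ?B"
    using im_cross_bilinear unfolding bilinear_def linear_iff
    by (simp add: matrix_vector_right_distrib matrix_vector_mult_scaleR)
  from orthogonal_sum_bilinear[OF this G2_matricesD(1)[OF g]]
  have "contraction (g ** A ** transpose g)
      = (\<Sum>j\<in>UNIV. im_cross (g *v (A *v axis j 1)) (g *v axis j 1))"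
    by (simp add: contraction_alt matrix_vector_mul_assoc[symmetric] G2_matricesD(5)[OF g]
        del: transpose_matrix_vector)
  also have "\<dots> = g *v contraction A"
    by (simp add: contraction_alt G2_matricesD(2)[OF g] linear_sum[OF matrix_vector_mul_linear])
  finally show ?thesis .
qed

text \<open>Signed permutation matrices, in the convention in which the \<open>i\<close>-th coordinate of the image is read off
  at \<open>p i\<close>.\<close>

definition monomial :: "(7 \<Rightarrow> real) \<Rightarrow> (7 \<Rightarrow> 7) \<Rightarrow> real^7^7" where
  "monomial s p = (\<chi> i j. if j = p i then s i else 0)"

lemma monomial_mult: "monomial s p *v x = (\<chi> i. s i * x $ p i)"
  by (simp add: monomial_def matrix_vector_mult_def vec_eq_iff if_distrib[of "\<lambda>r. r * _"] cong: if_cong)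

lemma matrix_conj_nth:
  "(g ** A ** transpose g) $ i $ j = (g *v (\<chi> k. (g *v A $ k) $ j)) $ i" for g A :: "real^'n^'n"
proof -
  have "(g ** A ** transpose g) $ i $ j = (g ** (A ** transpose g)) $ i $ j"
    by (simp add: matrix_mul_assoc)
  also have "\<dots> = (g *v (\<chi> k. (g *v A $ k) $ j)) $ i"
    by (simp add: matrix_matrix_mult_def matrix_vector_mult_def transpose_def mult.commute)
  finally show ?thesis .
qed

lemma mat_act_monomial:
  "mat_act (monomial s p) (v, A) = (\<chi> i. s i * v $ p i, \<chi> i j. s i * s j * A $ p i $ p j)"
  by (simp add: mat_act_def matrix_conj_nth monomial_mult vec_eq_iff mult.assoc)

lemma orthogonal_monomial:
  assumes "\<And>i. s i * s i = 1" "bij p"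
  shows "orthogonal_matrix (monomial s p)"
proof -
  have i: "p i = p j \<longleftrightarrow> i = j" for i j using assms(2) by (auto simp: bij_def inj_def)
  have "monomial s p ** transpose (monomial s p) = mat 1"
    using assms(1)
    by (auto simp: monomial_def matrix_matrix_mult_def transpose_def mat_def vec_eq_iff i
        if_distrib[of "\<lambda>r. r * _"] cong: if_cong)
  then show ?thesis
    by (metis orthogonal_matrix_def matrix_left_right_inverse)
qed

text \<open>The multiplication table is invariant under translation of the indices modulo 7, and under doubling
  them, which permutes the three quaternionic triples \<open>(1, 3)\<close>, \<open>(2, 6)\<close>, \<open>(4, 5)\<close> through \<open>0\<close> cyclically.\<close>

definition shift :: "7 \<Rightarrow> real^7^7" where "shift m = monomial (\<lambda>_. 1) (\<lambda>i. i + m)"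

definition doubling :: "real^7^7" where "doubling = monomial (\<lambda>_. 1) (\<lambda>i. 2 * i)"

text \<open>A sign change that is \<open>+1\<close> on a line of the Fano plane and \<open>-1\<close> off it preserves the product, since a line
  meets the complement of another one in \<open>0\<close> or \<open>2\<close> points. The lines are the translates of \<open>{0, 4, 5}\<close>.\<close>

definition line_sign :: "7 \<Rightarrow> real" where "line_sign i = (if i \<in> {0, 4, 5} then 1 else -1)"

definition sign_matrix :: "7 \<Rightarrow> real^7^7" where "sign_matrix m = monomial (\<lambda>i. line_sign (i + m)) (\<lambda>i. i)"

lemma shift_in_G2: "shift m \<in> G2_matrices"
proof -
  have "bij (\<lambda>i. i + m)"
    by (rule bij_betw_byWitness[of _ "\<lambda>i. i - m"]) auto
  moreover have "im_cross (shift m *v x) (shift m *v y) = shift m *v im_cross x y" for x y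
    by (simp add: shift_def monomial_mult im_cross_def vec_eq_iff add_ac)
  ultimately show ?thesis
    unfolding G2_matrices_def using orthogonal_monomial[of "\<lambda>_. 1"] by (simp add: shift_def)
qed

lemma doubling_in_G2: "doubling \<in> G2_matrices"
proof -
  have "\<forall>i j :: 7. 2 * i = 2 * j \<longrightarrow> i = j" unfolding forall_7 by simp
  then have "inj (\<lambda>i::7. 2 * i)" by (simp add: inj_def)
  then have "bij (\<lambda>i::7. 2 * i)" by (simp add: bij_def finite_UNIV_inj_surj)
  moreover have "im_cross (doubling *v x) (doubling *v y) = doubling *v im_cross x y" for x y
    unfolding vec_eq_iff forall_7
    by (simp add: doubling_def monomial_mult im_cross_def numerals_mod_7)
  ultimately show ?thesis
    unfolding G2_matrices_def using orthogonal_monomial[of "\<lambda>_. 1"] by (simp add: doubling_def)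
qed

lemma sign_matrix_in_G2: "sign_matrix m \<in> G2_matrices"
proof -
  have "\<forall>m k. line_sign (k + m) = line_sign (k + 1 + m) * line_sign (k + 3 + m) \<and> line_sign (k + m) = line_sign (k + 2 + m) * line_sign (k + 6 + m)
     \<and> line_sign (k + m) = line_sign (k + 4 + m) * line_sign (k + 5 + m)"
    unfolding forall_7 by (simp add: line_sign_def numerals_mod_7)
  then have *: "line_sign (k + 1 + m) * line_sign (k + 3 + m) = line_sign (k + m)"
    "line_sign (k + 2 + m) * line_sign (k + 6 + m) = line_sign (k + m)" "line_sign (k + 4 + m) * line_sign (k + 5 + m) = line_sign (k + m)"
    for k by metis+
  have r: "s * a * (t * b) = r * (a * b)" "t * b * (s * a) = r * (b * a)" if "s * t = r" for s a t b r :: real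
    using that by auto
  have "im_cross (sign_matrix m *v x) (sign_matrix m *v y) = sign_matrix m *v im_cross x y" for x y
    by (simp add: sign_matrix_def monomial_mult im_cross_def vec_eq_iff r[OF *(1)] r[OF *(2)] r[OF *(3)]
        right_diff_distrib distrib_left)
  moreover have "bij (\<lambda>i::7. i)" by (simp add: bij_def)
  moreover have "line_sign (i + m) * line_sign (i + m) = 1" for i by (simp add: line_sign_def)
  ultimately show ?thesis
    unfolding G2_matrices_def using orthogonal_monomial[of "\<lambda>i. line_sign (i + m)"] by (simp add: sign_matrix_def)
qed

text \<open>The rotation turns the complex line \<open>(e\<^sub>1, e\<^sub>3)\<close> by an angle and the line \<open>(e\<^sub>2, e\<^sub>6)\<close> by the opposite angle. With
  multiplication by \<open>e\<^sub>0\<close> as complex structure this is a diagonal element of \<open>SU(3)\<close>, the stabilizer of \<open>e\<^sub>0\<close>.\<close>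

definition rotation_fun :: "real \<Rightarrow> real \<Rightarrow> (7 \<Rightarrow> real) \<Rightarrow> 7 \<Rightarrow> real" where
  "rotation_fun c s x i = (if i = 1 then c * x 1 - s * x 3 else if i = 3 then s * x 1 + c * x 3
     else if i = 2 then c * x 2 + s * x 6 else if i = 6 then c * x 6 - s * x 2 else x i)"

definition rotation :: "real \<Rightarrow> real \<Rightarrow> real^7^7" where
  "rotation c s = (\<chi> i j. rotation_fun c s (\<lambda>k. if k = j then 1 else 0) i)"

lemma rotation_mult: "rotation c s *v x = (\<chi> i. rotation_fun c s (\<lambda>k. x $ k) i)"
  unfolding vec_eq_iff forall_7
  by (simp add: rotation_def rotation_fun_def matrix_vector_mult_def sum_7)

lemma rotation_in_G2:
  assumes cs: "c * c + s * s = 1"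
  shows "rotation c s \<in> G2_matrices"
proof -
  have ss: "s * s = 1 - c * c" "s * (s * z) = z - c * (c * z)" for z
  proof -
    show 1: "s * s = 1 - c * c" using cs by simp
    show "s * (s * z) = z - c * (c * z)" unfolding mult.assoc[symmetric] 1 by (simp add: left_diff_distrib)
  qed
  have "transpose (rotation c s) ** rotation c s = mat 1"
    unfolding vec_eq_iff forall_7
    using cs by (simp add: rotation_def rotation_fun_def matrix_matrix_mult_def transpose_def sum_7 mat_def add.commute)
  moreover have "im_cross (rotation c s *v x) (rotation c s *v y) = rotation c s *v im_cross x y" for x y
    unfolding vec_eq_iff forall_7
    by (intro conjI; simp add: rotation_mult rotation_fun_def im_cross_def numerals_mod_7 algebra_simps ss)
  ultimately show ?thesis by (simp add: G2_matrices_def orthogonal_matrix)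
qed

section \<open>Weights of the sign changes\<close>

definition G2_invariant :: "coords set \<Rightarrow> bool" where
  "G2_invariant S \<longleftrightarrow> subspace S \<and> (\<forall>g\<in>G2_matrices. \<forall>m\<in>S. mat_act g m \<in> S)"

lemma G2_invariantD:
  assumes "G2_invariant S"
  shows "subspace S" "0 \<in> S" "m \<in> S \<Longrightarrow> n \<in> S \<Longrightarrow> m + n \<in> S" "m \<in> S \<Longrightarrow> n \<in> S \<Longrightarrow> m - n \<in> S"
    "m \<in> S \<Longrightarrow> r *\<^sub>R m \<in> S" "g \<in> G2_matrices \<Longrightarrow> m \<in> S \<Longrightarrow> mat_act g m \<in> S"
  using assms by (auto simp: G2_invariant_def subspace_0 subspace_add subspace_diff subspace_scale)

text \<open>The ordered pairs \<open>(i, j)\<close> for which \<open>{0, i, j}\<close> is a line, in other words those for which \<open>e\<^sub>i \<otimes> e\<^sub>j\<close> has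
  the same weight under the sign changes as \<open>e\<^sub>0\<close>.\<close>

definition line_pairs :: "(7 \<times> 7) set" where
  "line_pairs = {(1,3), (3,1), (2,6), (6,2), (4,5), (5,4)}"

text \<open>Projection to the weight space of the sign changes that contains \<open>e\<^sub>0\<close>.\<close>

definition weight_part :: "coords \<Rightarrow> coords" where
  "weight_part m = (axis 0 (fst m $ 0),
     \<chi> i j. if (i, j) \<in> line_pairs then snd m $ i $ j else 0)"

text \<open>Projection to the trivial weight space of the sign changes.\<close>

definition diag_part :: "coords \<Rightarrow> coords" where
  "diag_part m = (0, \<chi> i j. if i = j then snd m $ i $ j else 0)"

lemma sign_average:
  assumes S: "G2_invariant S" and m: "(v, A) \<in> S"
  shows "(\<chi> i. (1 + line_sign (i + k)) / 2 * v $ i, \<chi> i j. (1 + line_sign (i + k) * line_sign (j + k)) / 2 * A $ i $ j) \<in> S"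
    and "(\<chi> i. (1 - line_sign (i + k)) / 2 * v $ i, \<chi> i j. (1 - line_sign (i + k) * line_sign (j + k)) / 2 * A $ i $ j) \<in> S"
proof -
  have g: "mat_act (sign_matrix k) (v, A) \<in> S"
    using G2_invariantD(6)[OF S sign_matrix_in_G2 m] .
  have "(1/2) *\<^sub>R ((v, A) + mat_act (sign_matrix k) (v, A)) \<in> S"
    "(1/2) *\<^sub>R ((v, A) - mat_act (sign_matrix k) (v, A)) \<in> S"
    using g m by (auto intro!: G2_invariantD[OF S])
  moreover have "(1/2) *\<^sub>R ((v, A) + mat_act (sign_matrix k) (v, A)) =
     (\<chi> i. (1 + line_sign (i + k)) / 2 * v $ i, \<chi> i j. (1 + line_sign (i + k) * line_sign (j + k)) / 2 * A $ i $ j)"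
    "(1/2) *\<^sub>R ((v, A) - mat_act (sign_matrix k) (v, A)) =
     (\<chi> i. (1 - line_sign (i + k)) / 2 * v $ i, \<chi> i j. (1 - line_sign (i + k) * line_sign (j + k)) / 2 * A $ i $ j)"
    unfolding sign_matrix_def mat_act_monomial by (simp_all add: vec_eq_iff algebra_simps)
  ultimately show "(\<chi> i. (1 + line_sign (i + k)) / 2 * v $ i, \<chi> i j. (1 + line_sign (i + k) * line_sign (j + k)) / 2 * A $ i $ j) \<in> S"
    and "(\<chi> i. (1 - line_sign (i + k)) / 2 * v $ i, \<chi> i j. (1 - line_sign (i + k) * line_sign (j + k)) / 2 * A $ i $ j) \<in> S"
    by simp_all
qed

lemma line_sign_simps [simp]:
  "line_sign 0 = 1" "line_sign 1 = -1" "line_sign 2 = -1" "line_sign 3 = -1" "line_sign 4 = 1" "line_sign 5 = 1" "line_sign 6 = -1"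
  by (simp_all add: line_sign_def)

text \<open>The sign changes with parameters \<open>0\<close> and \<open>4\<close> fix \<open>e\<^sub>0\<close> and the one with parameter \<open>1\<close> negates it; these three generate
  the group, so averaging over each of them with the matching sign projects to the weight of \<open>e\<^sub>0\<close>.\<close>

lemma weight_part_average:
  "weight_part (v, A) = (\<chi> i. (1 - line_sign (i + 1)) / 2 * ((1 + line_sign (i + 4)) / 2 * ((1 + line_sign (i + 0)) / 2 * v $ i)),
     \<chi> i j. (1 - line_sign (i + 1) * line_sign (j + 1)) / 2 * ((1 + line_sign (i + 4) * line_sign (j + 4)) / 2
       * ((1 + line_sign (i + 0) * line_sign (j + 0)) / 2 * A $ i $ j)))"
  unfolding prod_eq_iff vec_eq_iff forall_7
  by (simp add: weight_part_def line_pairs_def axis_def numerals_mod_7)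

lemma parts_in_invariant:
  assumes S: "G2_invariant S" and m: "m \<in> S"
  shows "weight_part m \<in> S" "diag_part m \<in> S"
proof -
  obtain v A where m': "m = (v, A)" by (cases m)
  note 1 = sign_average(1)[OF S m[unfolded m'], of 0]
  note 2 = sign_average(1)[OF S 1, of 4]
  note 3 = sign_average(2)[OF S 2, of 1] and 4 = sign_average(1)[OF S 2, of 1]
  from 3 show "weight_part m \<in> S" unfolding m' weight_part_average by simp
  have "diag_part m = (\<chi> i. (1 + line_sign (i + 1)) / 2 * ((1 + line_sign (i + 4)) / 2 * ((1 + line_sign (i + 0)) / 2 * v $ i)),
     \<chi> i j. (1 + line_sign (i + 1) * line_sign (j + 1)) / 2 * ((1 + line_sign (i + 4) * line_sign (j + 4)) / 2
       * ((1 + line_sign (i + 0) * line_sign (j + 0)) / 2 * A $ i $ j)))"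
    unfolding prod_eq_iff vec_eq_iff forall_7
    by (simp add: m' diag_part_def numerals_mod_7)
  with 4 show "diag_part m \<in> S" by simp
qed

lemma mat_act_shift: "mat_act (shift k) (v, A) = (\<chi> i. v $ (i + k), \<chi> i j. A $ (i + k) $ (j + k))"
  unfolding shift_def mat_act_monomial by simp

text \<open>Two distinct points of the Fano plane lie on exactly one line, hence determine one third point \<open>k\<close>.\<close>

lemma line_pair_count:
  "(\<Sum>k\<in>UNIV. if (i - k, j - k) \<in> line_pairs then 1 else 0) = (if i = j then 0 else 1 :: real)"
proof -
  have "(\<Sum>k\<in>UNIV. if (i - k, j - k) \<in> line_pairs then 1 else 0 :: real)
      = (\<Sum>l\<in>UNIV. if (l, l + (j - i)) \<in> line_pairs then 1 else 0)"
    by (rule sum.reindex_bij_witness[of _ "\<lambda>l. i - l" "\<lambda>k. i - k"]) auto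
  moreover have "\<forall>d. (\<Sum>l\<in>UNIV. if (l, l + d) \<in> line_pairs then 1 else 0) = (if d = 0 then 0 else 1 :: real)"
    unfolding forall_7 sum_7 line_pairs_def by simp
  ultimately show ?thesis by simp
qed

lemma ex_line_pair:
  assumes "i \<noteq> j" shows "\<exists>k. (i - k, j - k) \<in> line_pairs"
proof (rule ccontr)
  assume "\<nexists>k. (i - k, j - k) \<in> line_pairs"
  then show False
    using line_pair_count[of i j] assms by simp
qed

text \<open>An element is the sum of its weight components; those of the seven nontrivial weights are shifted to the
  weight of \<open>e\<^sub>0\<close>, projected, and shifted back.\<close>

lemma weight_decomposition:
  "m = diag_part m + (\<Sum>k\<in>UNIV. mat_act (shift (- k)) (weight_part (mat_act (shift k) m)))"
proof -
  obtain v A where m: "m = (v, A)" by (cases m)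
  have *: "mat_act (shift (- k)) (weight_part (mat_act (shift k) (v, A)))
      = (\<chi> i. if k = i then v $ i else 0,
         \<chi> i j. (if (i - k, j - k) \<in> line_pairs then 1 else 0) * A $ i $ j)" for k
    by (auto simp: mat_act_shift weight_part_def vec_eq_iff axis_def)
  show ?thesis
    by (simp add: m * prod_eq_iff vec_eq_iff fst_sum snd_sum diag_part_def
        sum_distrib_right[symmetric] line_pair_count)
qed

lemma in_invariantI:
  assumes S: "G2_invariant S" and "diag_part m \<in> S"
    and "\<And>k. weight_part (mat_act (shift k) m) \<in> S"
  shows "m \<in> S"
  by (subst weight_decomposition)
    (intro G2_invariantD(3)[OF S] subspace_sum G2_invariantD(1,6)[OF S] shift_in_G2 assms)

definition coords_1 :: "coords set" where "coords_1 = range (\<lambda>c. (0, c *\<^sub>R mat 1))"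
definition coords_7 :: "coords set" where "coords_7 = range (\<lambda>v. (v, 0))"
definition coords_7' :: "coords set" where "coords_7' = range (\<lambda>u. (0, cross_matrix u))"
definition coords_14 :: "coords set" where "coords_14 = {(0, A) | A. transpose A = - A \<and> contraction A = 0}"
definition coords_27 :: "coords set" where "coords_27 = {(0, A) | A. transpose A = A \<and> trace A = 0}"

text \<open>The general symmetric (\<open>t = 1\<close>) or skew (\<open>t = -1\<close>) matrix of the weight of \<open>e\<^sub>0\<close>.\<close>

definition line_matrix :: "real \<Rightarrow> real \<Rightarrow> real \<Rightarrow> real \<Rightarrow> real^7^7" where
  "line_matrix t a b c = (\<chi> i j. if (i, j) = (1, 3) then a else if (i, j) = (3, 1) then t * a
     else if (i, j) = (2, 6) then b else if (i, j) = (6, 2) then t * b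
     else if (i, j) = (4, 5) then c else if (i, j) = (5, 4) then t * c else 0)"

lemma weight_part_line_matrix:
  assumes "transpose A = t *\<^sub>R A"
  shows "weight_part (0, A) = (0, line_matrix t (A $ 1 $ 3) (A $ 2 $ 6) (A $ 4 $ 5))"
proof -
  have "A $ j $ i = t * A $ i $ j" for i j
    using arg_cong[OF assms, of "\<lambda>M. M $ i $ j"] by (simp add: transpose_def)
  from this[of 3 1] this[of 6 2] this[of 5 4]
  have "A $ 3 $ 1 = t * A $ 1 $ 3" "A $ 6 $ 2 = t * A $ 2 $ 6" "A $ 5 $ 4 = t * A $ 4 $ 5" .
  then show ?thesis
    unfolding prod_eq_iff vec_eq_iff forall_7
    by (simp add: weight_part_def line_matrix_def line_pairs_def axis_def)
qed

text \<open>The doubling carries \<open>(1, 3)\<close> to \<open>(2, 6)\<close> to \<open>(4, 5)\<close> and back to \<open>(1, 3)\<close>.\<close>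

lemma mat_act_doubling_line_matrix:
  "mat_act doubling (0, line_matrix t a b c) = (0, line_matrix t b c a)"
  unfolding doubling_def mat_act_monomial prod_eq_iff vec_eq_iff forall_7
  by (simp add: line_matrix_def numerals_mod_7)

lemma line_matrix_linear:
  "line_matrix t a b c + line_matrix t a' b' c' = line_matrix t (a + a') (b + b') (c + c')"
  "r *\<^sub>R line_matrix t a b c = line_matrix t (r * a) (r * b) (r * c)"
  unfolding vec_eq_iff forall_7 by (simp_all add: line_matrix_def algebra_simps)

lemma orthogonal_conj_mat: "orthogonal_matrix F \<Longrightarrow> F ** (c *\<^sub>R mat 1) ** transpose F = c *\<^sub>R mat 1"
  for F :: "real^'n^'n"
  by (simp add: orthogonal_matrix_def matrix_scalar_ac scalar_matrix_assoc[symmetric])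

lemma trace_conj:
  fixes F :: "real^'n^'n"
  assumes "orthogonal_matrix F" shows "trace (F ** A ** transpose F) = trace A"
  using assms trace_mul_sym[of "F ** A" "transpose F"]
  by (simp add: orthogonal_matrix_def matrix_mul_assoc)

lemma conj_zero [simp]: "F ** 0 ** transpose F = 0" for F :: "real^'n^'n"
  by (simp add: matrix_matrix_mult_def vec_eq_iff)

lemma transpose_conj: "transpose (F ** A ** transpose F) = F ** transpose A ** transpose F"
   for F :: "real^'n^'n"
  by (simp add: matrix_transpose_mul matrix_mul_assoc)

lemma conj_uminus: "F ** (- A) ** transpose F = - (F ** A ** transpose F)" for F :: "real^'n^'n"
  by (simp add: matrix_matrix_mult_def vec_eq_iff sum_negf)

lemma linear_transpose: "linear (transpose :: real^'n^'n \<Rightarrow> real^'n^'n)"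
  by (simp add: linear_iff transpose_def vec_eq_iff)

lemma linear_trace: "linear (trace :: real^'n^'n \<Rightarrow> real)"
  by (simp add: linear_iff trace_def sum.distrib sum_distrib_left)

lemma coords_submodules:
  shows "G2_invariant coords_1" "G2_invariant coords_7" "G2_invariant coords_7'"
    "G2_invariant coords_14" "G2_invariant coords_27"
proof -
  have "subspace coords_1"
    unfolding coords_1_def by (rule linear_subspace_image[of _ UNIV, simplified]) (simp_all add: linear_iff algebra_simps)
  then show "G2_invariant coords_1"
    by (auto simp: G2_invariant_def coords_1_def mat_act_def orthogonal_conj_mat dest!: G2_matricesD(1))
  have "subspace coords_7"
    unfolding coords_7_def by (rule linear_subspace_image[of _ UNIV, simplified]) (simp_all add: linear_iff algebra_simps)
  then show "G2_invariant coords_7"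
    by (auto simp: G2_invariant_def coords_7_def mat_act_def)
  have "subspace coords_7'"
    unfolding coords_7'_def by (rule linear_subspace_image[of _ UNIV, simplified])
     (simp_all add: linear_iff linear_add[OF linear_cross_matrix] linear_scale[OF linear_cross_matrix])
  then show "G2_invariant coords_7'"
    by (auto simp: G2_invariant_def coords_7'_def mat_act_def cross_matrix_equivariant)
  have "subspace coords_14"
    by (auto simp: subspace_def coords_14_def zero_prod_def linear_0[OF linear_contraction] linear_add[OF linear_contraction]
      linear_scale[OF linear_contraction] linear_add[OF linear_transpose] linear_scale[OF linear_transpose] linear_0[OF linear_transpose])
  then show "G2_invariant coords_14"
    by (auto simp: G2_invariant_def coords_14_def mat_act_def transpose_conj conj_uminus contraction_equivariant)
  have "subspace coords_27"
    by (auto simp: subspace_def coords_27_def zero_prod_def linear_0[OF linear_trace] linear_add[OF linear_trace]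
      linear_scale[OF linear_trace] linear_add[OF linear_transpose] linear_scale[OF linear_transpose] linear_0[OF linear_transpose])
  then show "G2_invariant coords_27"
    by (auto simp: G2_invariant_def coords_27_def mat_act_def transpose_conj trace_conj dest!: G2_matricesD(1))
qed

section \<open>Irreducibility of the five summands\<close>

lemma coords_1_irreducible:
  assumes S: "G2_invariant S" "S \<subseteq> coords_1" "S \<noteq> {0}"
  shows "S = coords_1"
proof -
  obtain c where c: "(0, c *\<^sub>R mat 1) \<in> S" "c \<noteq> 0"
    using S G2_invariantD(2)[OF S(1)] by (fastforce simp: coords_1_def zero_prod_def)
  have "(0, d *\<^sub>R mat 1) \<in> S" for d
    using G2_invariantD(5)[OF S(1) c(1), of "d / c"] c(2) by simp
  with S(2) show ?thesis by (auto simp: coords_1_def)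
qed

lemma weight_part_shift_7: "weight_part (mat_act (shift k) (v, 0)) = (v $ k *\<^sub>R axis 0 1, 0)"
  by (simp add: mat_act_shift weight_part_def vec_eq_iff axis_def)

lemma diag_part_7 [simp]: "diag_part (v, 0) = 0"
  by (simp add: diag_part_def vec_eq_iff zero_prod_def)

text \<open>Some weight component of a nonzero element is a multiple of a basis vector, and the shifts produce
  all the others from it.\<close>

lemma coords_7_irreducible:
  assumes S: "G2_invariant S" "S \<subseteq> coords_7" "S \<noteq> {0}"
  shows "S = coords_7"
proof -
  obtain v where v: "(v, 0) \<in> S" "v \<noteq> 0"
    using S G2_invariantD(2)[OF S(1)] by (fastforce simp: coords_7_def zero_prod_def)
  then obtain k where k: "v $ k \<noteq> 0" by (auto simp: vec_eq_iff)
  have "weight_part (mat_act (shift k) (v, 0)) \<in> S"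
    by (intro parts_in_invariant G2_invariantD(6)[OF S(1)] S shift_in_G2 v)
  then have "(1 / v $ k) *\<^sub>R (v $ k *\<^sub>R axis 0 1, 0) \<in> S"
    unfolding weight_part_shift_7 by (rule G2_invariantD(5)[OF S(1)])
  then have e: "(axis 0 1, 0) \<in> S" using k by simp
  have "(w, 0) \<in> S" for w
  proof (rule in_invariantI[OF S(1)])
    show "diag_part (w, 0) \<in> S" using G2_invariantD(2)[OF S(1)] by simp
    show "weight_part (mat_act (shift k) (w, 0)) \<in> S" for k
      using G2_invariantD(5)[OF S(1) e, of "w $ k"] by (simp add: weight_part_shift_7)
  qed
  with S(2) show ?thesis by (auto simp: coords_7_def)
qed

text \<open>Transport along the equivariant isomorphism \<open>u \<mapsto> X(u)\<close> from the first 7-dimensional summand.\<close>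

lemma coords_7'_irreducible:
  assumes S: "G2_invariant S" "S \<subseteq> coords_7'" "S \<noteq> {0}"
  shows "S = coords_7'"
proof -
  let ?S = "{(u, 0) | u. (0, cross_matrix u) \<in> S} :: coords set"
  note [simp] = linear_0[OF linear_cross_matrix] linear_add[OF linear_cross_matrix] linear_scale[OF linear_cross_matrix]
  have "G2_invariant ?S"
    unfolding G2_invariant_def
  proof (intro conjI ballI)
    show "subspace ?S"
      unfolding subspace_def
    proof (intro conjI ballI allI)
      show "0 \<in> ?S" using G2_invariantD(2)[OF S(1)] by (simp add: zero_prod_def)
      show "m + n \<in> ?S" if "m \<in> ?S" "n \<in> ?S" for m n
        using that by (auto dest: G2_invariantD(3)[OF S(1)])
      show "r *\<^sub>R m \<in> ?S" if "m \<in> ?S" for r m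
        using that by (auto dest: G2_invariantD(5)[OF S(1), of _ r])
    qed
    show "mat_act g m \<in> ?S" if "g \<in> G2_matrices" "m \<in> ?S" for g m
      using that by (auto simp: mat_act_def cross_matrix_equivariant
          dest: G2_invariantD(6)[OF S(1) \<open>g \<in> G2_matrices\<close>])
  qed
  moreover have "?S \<noteq> {0}"
  proof -
    obtain u where "(0, cross_matrix u) \<in> S" "cross_matrix u \<noteq> 0"
      using S G2_invariantD(2)[OF S(1)] by (fastforce simp: coords_7'_def zero_prod_def)
    then have "(u, 0) \<in> ?S" "u \<noteq> 0" by auto
    then show ?thesis by (auto simp: zero_prod_def)
  qed
  moreover have "?S \<subseteq> coords_7" by (auto simp: coords_7_def)
  ultimately have "?S = coords_7" by (intro coords_7_irreducible)
  then have "(0, cross_matrix u) \<in> S" for u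
    by (auto simp: coords_7_def set_eq_iff)
  with S(2) show ?thesis by (auto simp: coords_7'_def)
qed

lemma transpose_nth: "transpose A = t *\<^sub>R A \<Longrightarrow> A $ j $ i = t * A $ i $ j" for A :: "real^'n^'n"
  by (drule arg_cong[where f = "\<lambda>M. M $ i $ j"]) (simp add: transpose_def)

lemma weight_part_shift_line:
  assumes "transpose A = t *\<^sub>R A"
  shows "weight_part (mat_act (shift k) (0, A)) = (0, line_matrix t (A $ (1+k) $ (3+k)) (A $ (2+k) $ (6+k)) (A $ (4+k) $ (5+k)))"
proof -
  have "transpose (\<chi> i j. A $ (i + k) $ (j + k)) = t *\<^sub>R (\<chi> i j. A $ (i + k) $ (j + k))"
    by (simp add: transpose_def vec_eq_iff) (intro allI transpose_nth assms)
  from weight_part_line_matrix[OF this] show ?thesis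
    by (simp add: mat_act_shift zero_vec_def)
qed

lemma line_matrix_eq_0: "line_matrix t 0 0 0 = 0"
  by (simp add: line_matrix_def vec_eq_iff)

text \<open>A nonzero entry off the diagonal lies on a line with some third point \<open>k\<close>, so the weight component
  belonging to \<open>k\<close> does not vanish.\<close>

lemma off_diagonal_line_matrix:
  assumes "transpose A = t *\<^sub>R A" "i \<noteq> j" "A $ i $ j \<noteq> 0"
  shows "\<exists>k a b c. weight_part (mat_act (shift k) (0, A)) = (0, line_matrix t a b c) \<and> (a \<noteq> 0 \<or> b \<noteq> 0 \<or> c \<noteq> 0)"
proof -
  obtain k where k: "(i - k, j - k) \<in> line_pairs" using ex_line_pair[OF assms(2)] by blast
  obtain a b c where abc: "weight_part (mat_act (shift k) (0, A)) = (0, line_matrix t a b c)"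
    using weight_part_shift_line[OF assms(1)] by blast
  have "snd (weight_part (mat_act (shift k) (0, A))) $ (i - k) $ (j - k) = A $ i $ j"
    using k by (simp add: weight_part_def mat_act_shift)
  with abc assms(3) have "line_matrix t a b c \<noteq> 0" by auto
  then have "a \<noteq> 0 \<or> b \<noteq> 0 \<or> c \<noteq> 0" using line_matrix_eq_0 by metis
  with abc show ?thesis by blast
qed

text \<open>This is the equation that makes the weight spaces of the 14-dimensional summand two-dimensional.\<close>

lemma line_matrix_coords_14: "(0, line_matrix (-1) a b c) \<in> coords_14 \<Longrightarrow> a + b + c = 0"
proof -
  assume "(0, line_matrix (-1) a b c) \<in> coords_14"
  then have "contraction (line_matrix (-1) a b c) $ 0 = 0" by (simp add: coords_14_def)
  then show ?thesis by (simp add: contraction_def line_matrix_def numerals_mod_7)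
qed

lemma diag_part_coords_14: "m \<in> coords_14 \<Longrightarrow> diag_part m = 0"
proof -
  assume "m \<in> coords_14"
  then obtain A where A: "m = (0, A)" "transpose A = - A" by (auto simp: coords_14_def)
  have "A $ i $ i = 0" for i
    using arg_cong[OF A(2), of "\<lambda>M. M $ i $ i"] by (simp add: transpose_def)
  then show ?thesis by (simp add: A diag_part_def vec_eq_iff zero_prod_def)
qed

text \<open>A nonzero weight vector \<open>(a, b, c)\<close> with \<open>a + b + c = 0\<close> and its cyclic permutation \<open>(b, c, a)\<close> are linearly
  independent, because their determinant is the definite form \<open>a\<^sup>2 + a b + b\<^sup>2\<close> up to sign. Hence a nonzero submodule
  contains the whole weight space, and by the shifts all weight spaces.\<close>

lemma coords_14_irreducible:
  assumes S: "G2_invariant S" "S \<subseteq> coords_14" "S \<noteq> {0}"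
  shows "S = coords_14"
proof -
  have t: "transpose A = (-1) *\<^sub>R A" if "(0, A) \<in> coords_14" for A
    using that by (simp add: coords_14_def)
  obtain A where A: "(0, A) \<in> S" "A \<noteq> 0"
    using S G2_invariantD(2)[OF S(1)] by (fastforce simp: coords_14_def zero_prod_def)
  have tA: "transpose A = (-1) *\<^sub>R A" using A S t by blast
  from A(2) obtain i j where ij: "A $ i $ j \<noteq> 0" by (auto simp: vec_eq_iff)
  moreover have "i \<noteq> j"
    using ij arg_cong[OF tA, of "\<lambda>M. M $ i $ i"] by (auto simp: transpose_def)
  ultimately obtain k a b c where abc: "weight_part (mat_act (shift k) (0, A)) = (0, line_matrix (-1) a b c)"
    and nz: "a \<noteq> 0 \<or> b \<noteq> 0 \<or> c \<noteq> 0"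
    using off_diagonal_line_matrix[OF tA] by blast
  have L: "(0, line_matrix (-1) a b c) \<in> S"
    unfolding abc[symmetric] by (intro parts_in_invariant G2_invariantD(6)[OF S(1)] S shift_in_G2 A)
  have L': "(0, line_matrix (-1) b c a) \<in> S"
    using G2_invariantD(6)[OF S(1) doubling_in_G2 L] by (simp add: mat_act_doubling_line_matrix)
  have c: "c = - a - b" using line_matrix_coords_14[of a b c] L S(2) by auto
  have all: "(0, line_matrix (-1) p q r) \<in> S" if "p + q + r = 0" for p q r
  proof -
    define d where "d = a * a + a * b + b * b"
    have "d \<noteq> 0"
    proof
      assume "d = 0"
      \<comment> \<open>completing the square: \<open>4 d = (2 a + b)\<^sup>2 + 3 b\<^sup>2\<close>\<close>
      then have "(2 * a + b)\<^sup>2 + 3 * b\<^sup>2 = 0" by (simp add: d_def power2_eq_square algebra_simps)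
      then have "b = 0" "2 * a + b = 0" by (smt (verit) zero_le_power2 power_eq_0_iff)+
      with nz c show False by simp
    qed
    \<comment> \<open>Cramer's rule for \<open>(p, q, r) = x (a, b, c) + y (b, c, a)\<close>, with determinant \<open>- d\<close>\<close>
    define x where "x = ((a + b) * p + b * q) / d"
    define y where "y = (b * p - a * q) / d"
    have "x * a + y * b = p"
      using \<open>d \<noteq> 0\<close> by (simp add: x_def y_def divide_simps) (simp add: d_def algebra_simps)
    moreover have "x * b + y * c = q"
      using \<open>d \<noteq> 0\<close> by (simp add: x_def y_def c divide_simps) (simp add: d_def algebra_simps)
    moreover have "r = - p - q" using that by simp
    moreover have "x * c + y * a = - (x * a + y * b) - (x * b + y * c)" by (simp add: c algebra_simps)
    ultimately have "x *\<^sub>R (0, line_matrix (-1) a b c) + y *\<^sub>R (0, line_matrix (-1) b c a) = (0, line_matrix (-1) p q r)"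
      by (simp add: line_matrix_linear)
    then show ?thesis
      using G2_invariantD(3,5)[OF S(1)] L L' by metis
  qed
  have "m \<in> S" if m: "m \<in> coords_14" for m
  proof (rule in_invariantI[OF S(1)])
    show "diag_part m \<in> S" using diag_part_coords_14[OF m] G2_invariantD(2)[OF S(1)] by simp
    fix k
    obtain A where A: "m = (0, A)" using m by (auto simp: coords_14_def)
    obtain p q r where w: "weight_part (mat_act (shift k) m) = (0, line_matrix (-1) p q r)"
      using weight_part_shift_line[OF t] m A by blast
    have "weight_part (mat_act (shift k) m) \<in> coords_14"
      by (intro parts_in_invariant G2_invariantD(6) coords_submodules shift_in_G2 m)
    then show "weight_part (mat_act (shift k) m) \<in> S" unfolding w using line_matrix_coords_14 all by blast
  qed
  with S(2) show ?thesis by blast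
qed

definition diag_matrix :: "(7 \<Rightarrow> real) \<Rightarrow> real^7^7" where
  "diag_matrix d = (\<chi> i j. if i = j then d i else 0)"

text \<open>A quarter turn maps \<open>e\<^sub>1 e\<^sub>3\<close> and \<open>e\<^sub>2 e\<^sub>6\<close> (as symmetric tensors) to their negatives and fixes \<open>e\<^sub>4 e\<^sub>5\<close>; it
  therefore separates the third coordinate from the other two.\<close>

lemma mat_act_rotation_line_matrix:
  "mat_act (rotation 0 1) (0, line_matrix 1 a b c) = (0, line_matrix 1 (- a) (- b) c)"
  unfolding prod_eq_iff vec_eq_iff forall_7 mat_act_def fst_conv snd_conv matrix_conj_nth rotation_mult
  by (simp add: rotation_fun_def line_matrix_def)

text \<open>The angle with cosine \<open>3/5\<close> and sine \<open>4/5\<close> is used only because it is rational and not a multiple of a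
  quarter turn: the image of \<open>e\<^sub>1 e\<^sub>3\<close> then has a nonzero multiple of \<open>e\<^sub>3\<^sup>2 - e\<^sub>1\<^sup>2\<close> in its diagonal part.\<close>

lemma diag_part_rotation_line_matrix:
  "diag_part (mat_act (rotation (3/5) (4/5)) (0, line_matrix 1 a 0 0))
     = (24/25 * a) *\<^sub>R (0, diag_matrix (\<lambda>i. (if i = 3 then 1 else 0) - (if i = 1 then 1 else 0)))"
  unfolding prod_eq_iff vec_eq_iff forall_7 mat_act_def fst_conv snd_conv matrix_conj_nth rotation_mult diag_part_def
  by (simp add: rotation_fun_def line_matrix_def diag_matrix_def matrix_conj_nth rotation_mult)

lemma weight_part_rotation_diag_matrix:
  "weight_part (mat_act (rotation (3/5) (4/5)) (0, diag_matrix d))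
     = (0, line_matrix 1 (12/25 * (d 1 - d 3)) (12/25 * (d 6 - d 2)) 0)"
  unfolding prod_eq_iff vec_eq_iff forall_7 mat_act_def fst_conv snd_conv weight_part_def
  by (simp add: rotation_fun_def line_matrix_def diag_matrix_def matrix_conj_nth rotation_mult line_pairs_def axis_def)

lemma rotation_instances: "rotation 0 1 \<in> G2_matrices" "rotation (3/5) (4/5) \<in> G2_matrices"
  by (simp_all add: rotation_in_G2)

text \<open>The shifts of \<open>e\<^sub>3\<^sup>2 - e\<^sub>1\<^sup>2\<close> are the differences of squares at indices two apart. As 2 generates the integers
  modulo 7, these telescope to all differences, which span the trace-free diagonal matrices.\<close>

lemma diag_matrix_mem:
  assumes S: "G2_invariant S"
    and e: "(0, diag_matrix (\<lambda>i. (if i = 3 then 1 else 0) - (if i = 1 then 1 else 0))) \<in> S"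
    and d: "(\<Sum>i\<in>UNIV. d i) = 0"
  shows "(0, diag_matrix d) \<in> S"
proof -
  let ?d = "\<lambda>a b i::7. (if i = a then 1 else 0) - (if i = b then 1 else 0 :: real)"
  have step: "(0, diag_matrix (?d (a + 2) a)) \<in> S" for a
  proof -
    have "mat_act (shift (1 - a)) (0, diag_matrix (?d 3 1)) = (0, diag_matrix (?d (a + 2) a))"
    proof -
      have "\<forall>a i :: 7. (i + (1 - a) = 3 \<longleftrightarrow> i = a + 2) \<and> (i + (1 - a) = 1 \<longleftrightarrow> i = a)"
        unfolding forall_7 by simp
      then show ?thesis by (simp add: mat_act_shift diag_matrix_def vec_eq_iff)
    qed
    then show ?thesis using G2_invariantD(6)[OF S shift_in_G2 e, of "1 - a"] by (simp only:)
  qed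
  have trans: "(0, diag_matrix (?d a c)) \<in> S" if "(0, diag_matrix (?d a b)) \<in> S" "(0, diag_matrix (?d b c)) \<in> S" for a b c
  proof -
    have "(0, diag_matrix (?d a b)) + (0, diag_matrix (?d b c)) = ((0, diag_matrix (?d a c)) :: coords)"
      by (rule prod_eqI) (simp_all add: diag_matrix_def vec_eq_iff)
    with G2_invariantD(3)[OF S that] show ?thesis by simp
  qed
  have "(0, diag_matrix (?d 0 0)) = (0 :: coords)" by (simp add: diag_matrix_def vec_eq_iff zero_prod_def)
  then have z: "(0, diag_matrix (?d 0 0)) \<in> S" using G2_invariantD(2)[OF S] by simp
  have 2: "(0, diag_matrix (?d 2 0)) \<in> S" using step[of 0] by simp
  have 4: "(0, diag_matrix (?d 4 0)) \<in> S" using trans[OF _ 2] step[of 2] by simp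
  have 6: "(0, diag_matrix (?d 6 0)) \<in> S" using trans[OF _ 4] step[of 4] by simp
  have 1: "(0, diag_matrix (?d 1 0)) \<in> S" using trans[OF _ 6] step[of 6] by (simp add: numerals_mod_7)
  have 3: "(0, diag_matrix (?d 3 0)) \<in> S" using trans[OF _ 1] step[of 1] by simp
  have 5: "(0, diag_matrix (?d 5 0)) \<in> S" using trans[OF _ 3] step[of 3] by simp
  have all: "(0, diag_matrix (?d a 0)) \<in> S" for a
    using forall_7[of "\<lambda>a. (0, diag_matrix (?d a 0)) \<in> S"] z 1 2 3 4 5 6 by blast
  have "((0, diag_matrix d) :: coords) = (\<Sum>a\<in>UNIV. d a *\<^sub>R (0, diag_matrix (?d a 0)))"
  proof -
    have "d 0 = - (d 1 + d 2 + d 3 + d 4 + d 5 + d 6)" using d by (simp add: sum_7)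
    then show ?thesis
      unfolding prod_eq_iff vec_eq_iff forall_7 sum_7
      by (simp add: diag_matrix_def)
  qed
  also have "\<dots> \<in> S"
    by (intro subspace_sum G2_invariantD(1,5)[OF S] all)
  finally show ?thesis .
qed

text \<open>Every nonzero submodule contains the tensor \<open>e\<^sub>4 e\<^sub>5\<close>. If it has an element with a nonzero entry off the diagonal,
  a weight component of that element is \<open>(a, b, c) \<noteq> 0\<close>, and the quarter turn isolates a nonzero coordinate. Otherwise it contains a
  diagonal matrix with two distinct entries at indices two apart, which the oblique rotation turns into
  an element of the first kind. Conversely, \<open>e\<^sub>4 e\<^sub>5\<close> yields all weight vectors by doubling and shifts, and the trace-free diagonal
  matrices by the oblique rotation.\<close>

lemma coords_27_irreducible:
  assumes S: "G2_invariant S" "S \<subseteq> coords_27" "S \<noteq> {0}"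
  shows "S = coords_27"
proof -
  note inv = G2_invariantD[OF S(1)]
  have t: "transpose A = 1 *\<^sub>R A" if "(0, A) \<in> coords_27" for A
    using that by (simp add: coords_27_def)
  have rotate: "(0, line_matrix 1 b c a) \<in> S" if "(0, line_matrix 1 a b c) \<in> S" for a b c
    using inv(6)[OF doubling_in_G2 that] by (simp add: mat_act_doubling_line_matrix)
  have isolate: "(0, line_matrix 1 0 0 c) \<in> S" if "(0, line_matrix 1 a b c) \<in> S" for a b c
  proof -
    have "(1/2) *\<^sub>R ((0, line_matrix 1 a b c) + mat_act (rotation 0 1) (0, line_matrix 1 a b c)) \<in> S"
      using that by (intro inv rotation_instances)
    then show ?thesis by (simp add: mat_act_rotation_line_matrix line_matrix_linear)
  qed
  have one: "(0, line_matrix 1 0 0 1) \<in> S" if L: "(0, line_matrix 1 a b c) \<in> S" and nz: "a \<noteq> 0 \<or> b \<noteq> 0 \<or> c \<noteq> 0" for a b c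
  proof -
    obtain d where d: "(0, line_matrix 1 0 0 d) \<in> S" "d \<noteq> 0"
      using nz isolate[OF L] isolate[OF rotate[OF L]] isolate[OF rotate[OF rotate[OF L]]] by blast
    then show ?thesis using inv(5)[OF d(1), of "1/d"] by (simp add: line_matrix_linear)
  qed
  obtain A where A: "(0, A) \<in> S" "A \<noteq> 0"
    using S inv(2) by (fastforce simp: coords_27_def zero_prod_def)
  have mem: "(0, A) \<in> coords_27" using A(1) S(2) by blast
  have tA: "transpose A = 1 *\<^sub>R A" "trace A = 0" using t[OF mem] mem by (simp_all add: coords_27_def)
  have e: "(0, line_matrix 1 0 0 1) \<in> S"
  proof (cases "\<exists>i j. i \<noteq> j \<and> A $ i $ j \<noteq> 0")
    case True
    then obtain k a b c where "weight_part (mat_act (shift k) (0, A)) = (0, line_matrix 1 a b c)" "a \<noteq> 0 \<or> b \<noteq> 0 \<or> c \<noteq> 0"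
      using off_diagonal_line_matrix[OF tA(1)] by blast
    moreover have "weight_part (mat_act (shift k) (0, A)) \<in> S"
      by (intro parts_in_invariant inv S shift_in_G2 A)
    ultimately show ?thesis using one by metis
  next
    case False
    define d where "d i = A $ i $ i" for i
    have Ad: "A = diag_matrix d" using False by (auto simp: diag_matrix_def d_def vec_eq_iff)
    have "\<exists>k. d (1 + k) \<noteq> d (3 + k)"
    proof (rule ccontr)
      assume "\<nexists>k. d (1 + k) \<noteq> d (3 + k)"
      then have eq: "d (1 + k) = d (3 + k)" for k by blast
      have "d 1 = d 0" "d 2 = d 0" "d 3 = d 0" "d 4 = d 0" "d 5 = d 0" "d 6 = d 0"
        using eq[of 0] eq[of 1] eq[of 2] eq[of 3] eq[of 4] eq[of 5] eq[of 6] by (simp_all add: numerals_mod_7)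
      moreover from this have "d 0 = 0" using tA(2) by (simp add: trace_def sum_7 d_def)
      ultimately have "\<forall>i. d i = 0" unfolding forall_7 by simp
      then have "A = 0" unfolding Ad by (simp add: diag_matrix_def vec_eq_iff)
      with A(2) show False ..
    qed
    then obtain k where k: "d (1 + k) \<noteq> d (3 + k)" by blast
    have "mat_act (shift k) (0, A) = (0, diag_matrix (\<lambda>i. d (i + k)))"
      by (simp add: Ad mat_act_shift diag_matrix_def vec_eq_iff)
    moreover have "weight_part (mat_act (rotation (3/5) (4/5)) (mat_act (shift k) (0, A))) \<in> S"
      by (intro parts_in_invariant inv S rotation_instances shift_in_G2 A)
    ultimately show ?thesis
      using one k by (simp add: weight_part_rotation_diag_matrix)
  qed
  have all: "(0, line_matrix 1 a b c) \<in> S" for a b c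
  proof -
    have "a *\<^sub>R (0, line_matrix 1 1 0 0) + (b *\<^sub>R (0, line_matrix 1 0 1 0) + c *\<^sub>R (0, line_matrix 1 0 0 1)) \<in> S"
      using e rotate[OF e] rotate[OF rotate[OF e]] by (intro inv)
    then show ?thesis by (simp add: line_matrix_linear)
  qed
  \<comment> \<open>the entry \<open>25/24\<close> normalizes the resulting diagonal matrix, as \<open>2 \<cdot> 3/5 \<cdot> 4/5 = 24/25\<close>\<close>
  have "diag_part (mat_act (rotation (3/5) (4/5)) (0, line_matrix 1 (25/24) 0 0)) \<in> S"
    by (intro parts_in_invariant inv S rotation_instances all)
  then have e': "(0, diag_matrix (\<lambda>i. (if i = 3 then 1 else 0) - (if i = 1 then 1 else 0))) \<in> S"
    unfolding diag_part_rotation_line_matrix by simp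
  have "m \<in> S" if m: "m \<in> coords_27" for m
  proof (rule in_invariantI[OF S(1)])
    obtain A where A: "m = (0, A)" "trace A = 0" using m by (auto simp: coords_27_def)
    have "diag_part m = (0, diag_matrix (\<lambda>i. A $ i $ i))"
      by (auto simp: A diag_part_def diag_matrix_def vec_eq_iff)
    then show "diag_part m \<in> S"
      using diag_matrix_mem[OF S(1) e', of "\<lambda>i. A $ i $ i"] A(2) by (simp add: trace_def)
    show "weight_part (mat_act (shift k) m) \<in> S" for k
      using weight_part_shift_line[OF t] m A all by metis
  qed
  with S(2) show ?thesis by blast
qed

section \<open>Equivariant images of the 7-dimensional representation\<close>

text \<open>The 14-dimensional sum of both 7-dimensional summands.\<close>

definition coords_77 :: "coords set" where
  "coords_77 = range (\<lambda>(v, u). (v, cross_matrix u))"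

lemma coords_77I: "(v, cross_matrix u) \<in> coords_77"
  unfolding coords_77_def by (rule image_eqI[of _ _ "(v, u)"]) simp_all

lemma coords_77_invariant: "G2_invariant coords_77"
proof -
  have "linear (\<lambda>(v, u). (v, cross_matrix u))"
    by (simp add: linear_iff linear_add[OF linear_cross_matrix] linear_scale[OF linear_cross_matrix] split: prod.split)
  then have "subspace coords_77"
    unfolding coords_77_def by (rule linear_subspace_image[of _ UNIV, simplified])
  then show ?thesis
    by (auto simp: G2_invariant_def coords_77_def mat_act_def cross_matrix_equivariant)
qed

lemma axis_stabilizer:
  "sign_matrix m *v axis 0 1 = line_sign m *\<^sub>R axis 0 1" "doubling *v axis 0 1 = axis 0 1" "rotation 0 1 *v axis 0 1 = axis 0 1"
  "shift (- k) *v axis 0 1 = axis k 1"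
proof -
  show "sign_matrix m *v axis 0 1 = line_sign m *\<^sub>R axis 0 1"
    by (simp add: sign_matrix_def monomial_mult vec_eq_iff axis_def)
  show "doubling *v axis 0 1 = axis 0 1" "rotation 0 1 *v axis 0 1 = axis 0 1"
    unfolding vec_eq_iff forall_7 by (simp_all add: doubling_def monomial_mult axis_def rotation_mult rotation_fun_def)
  show "shift (- k) *v axis 0 1 = axis k 1"
    by (auto simp: shift_def monomial_mult axis_def vec_eq_iff)
qed

text \<open>The sign changes restrict \<open>(v, A)\<close> to the weight of \<open>e\<^sub>0\<close>. The doubling makes the three entries at \<open>(1, 3)\<close>, \<open>(2, 6)\<close>,
  \<open>(4, 5)\<close> equal, likewise the three transposed ones, and the quarter turn makes the latter the negatives of the
  former. What remains is \<open>(v\<^sub>0 e\<^sub>0, X(a e\<^sub>0))\<close>.\<close>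

lemma axis_stabilizer_fixed:
  assumes sgn: "\<And>m. mat_act (sign_matrix m) x = line_sign m *\<^sub>R x"
    and doubling: "mat_act doubling x = x" and rotation: "mat_act (rotation 0 1) x = x"
  shows "x \<in> coords_77"
proof -
  obtain v A where x: "x = (v, A)" by (cases x)
  have "line_sign (i + m) * v $ i = line_sign m * v $ i" "line_sign (i + m) * line_sign (j + m) * A $ i $ j = line_sign m * A $ i $ j" for m i j
    using sgn[of m] by (simp_all add: x sign_matrix_def mat_act_monomial vec_eq_iff)
  note fixed = this
  have plus: "(1 + f) / 2 * a = a" if "f * a = 1 * a" for f a :: real
    using that by (simp add: field_simps)
  have minus: "(1 - f) / 2 * a = a" if "f * a = - 1 * a" for f a :: real
    using that by (simp add: field_simps)
  \<comment> \<open>each of the three averages that make up \<open>weight_part\<close> fixes \<open>x\<close>\<close>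
  have "weight_part x = x"
    unfolding x weight_part_average
      plus[OF fixed(1)[of _ 0, unfolded line_sign_simps]] plus[OF fixed(1)[of _ 4, unfolded line_sign_simps]]
      minus[OF fixed(1)[of _ 1, unfolded line_sign_simps]]
      plus[OF fixed(2)[of _ 0, unfolded line_sign_simps]] plus[OF fixed(2)[of _ 4, unfolded line_sign_simps]]
      minus[OF fixed(2)[of _ 1, unfolded line_sign_simps]]
    by (simp add: vec_eq_iff)
  then have w: "fst x = fst (weight_part x)" "snd x = snd (weight_part x)" by simp_all
  have wp: "v = axis 0 (v $ 0)" using w(1) by (simp add: x weight_part_def)
  have wp2: "A $ i $ j = 0" if "(i, j) \<notin> line_pairs" for i j
    using arg_cong[OF w(2), of "\<lambda>M. M $ i $ j"] that by (simp add: x weight_part_def)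
  have d: "A $ (2 * i) $ (2 * j) = A $ i $ j" for i j
    using doubling by (simp add: x doubling_def mat_act_monomial vec_eq_iff)
  have d': "A $ 2 $ 6 = A $ 1 $ 3" "A $ 6 $ 2 = A $ 3 $ 1" "A $ 4 $ 5 = A $ 1 $ 3" "A $ 5 $ 4 = A $ 3 $ 1"
    using d[of 1 3] d[of 3 1] d[of 2 6] d[of 6 2] by (simp_all add: numerals_mod_7)
  have "snd (mat_act (rotation 0 1) x) $ 1 $ 3 = - A $ 3 $ 1"
    by (simp add: x mat_act_def matrix_conj_nth rotation_mult rotation_fun_def)
  then have r: "A $ 3 $ 1 = - A $ 1 $ 3" using rotation by (simp add: x)
  have "A = cross_matrix (axis 0 (A $ 1 $ 3))"
    unfolding vec_eq_iff forall_7
    by (simp add: wp2 line_pairs_def d' r cross_matrix_def im_cross_def axis_def numerals_mod_7)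
  with wp show ?thesis unfolding x coords_77_def by (metis (mono_tags, lifting) case_prod_conv rangeI)
qed

text \<open>An equivariant map sends \<open>e\<^sub>0\<close> to a vector with the symmetries of \<open>e\<^sub>0\<close>; the shifts carry this information to
  the other basis vectors.\<close>

lemma equivariant_in_coords_77:
  assumes T: "linear T" "\<And>g x. g \<in> G2_matrices \<Longrightarrow> T (g *v x) = mat_act g (T x)"
  shows "T x \<in> coords_77"
proof -
  have "T (axis 0 1) \<in> coords_77"
  proof (rule axis_stabilizer_fixed)
    show "mat_act (sign_matrix m) (T (axis 0 1)) = line_sign m *\<^sub>R T (axis 0 1)" for m
      using T(2)[OF sign_matrix_in_G2, of m "axis 0 1"] by (simp add: axis_stabilizer linear_scale[OF T(1)])
    show "mat_act doubling (T (axis 0 1)) = T (axis 0 1)"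
      using T(2)[OF doubling_in_G2, of "axis 0 1"] by (simp add: axis_stabilizer)
    show "mat_act (rotation 0 1) (T (axis 0 1)) = T (axis 0 1)"
      using T(2)[OF rotation_in_G2[of 0 1], of "axis 0 1"] by (simp add: axis_stabilizer)
  qed
  then have ax: "T (axis k 1) \<in> coords_77" for k
    using G2_invariantD(6)[OF coords_77_invariant shift_in_G2, of "T (axis 0 1)" "- k"]
      T(2)[OF shift_in_G2, of "- k" "axis 0 1"] by (simp add: axis_stabilizer)
  have "T x = T (\<Sum>k\<in>UNIV. x $ k *\<^sub>R axis k 1)"
    using basis_expansion[of x] by (simp add: scalar_mult_eq_scaleR)
  also have "\<dots> = (\<Sum>k\<in>UNIV. x $ k *\<^sub>R T (axis k 1))"
    by (simp add: linear_sum[OF T(1)] linear_scale[OF T(1)])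
  also have "\<dots> \<in> coords_77"
    by (intro subspace_sum G2_invariantD(1,5)[OF coords_77_invariant] ax)
  finally show ?thesis .
qed

section \<open>The decomposition and the eigenspaces in coordinates\<close>

lemma trace_transpose: "trace (transpose A) = trace A" for A :: "real^'n^'n"
  by (simp add: trace_def transpose_def)

lemma contraction_transpose: "contraction (transpose A) = - contraction A"
  by (simp add: contraction_def transpose_def vec_eq_iff)

lemma transpose_cross_matrix: "transpose (cross_matrix u) = - cross_matrix u"
  unfolding vec_eq_iff forall_7
  by (simp add: cross_matrix_def im_cross_def axis_def transpose_def numerals_mod_7)

lemma trace_skew: "transpose A = - A \<Longrightarrow> trace A = 0" for A :: "real^'n^'n"
  using trace_transpose[of A] linear_neg[OF linear_trace, of A] by simp

lemma contraction_symmetric: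
  assumes "transpose A = A" shows "contraction A = 0"
proof -
  have "contraction A $ k = 0" for k
    using arg_cong[OF contraction_transpose[of A], of "\<lambda>v. v $ k"] assms by simp
  then show ?thesis by (simp add: vec_eq_iff)
qed

lemma trace_mat_1: "trace (mat 1 :: real^7^7) = 7"
  by (simp add: trace_def mat_def)

lemmas cross_matrix_linear = linear_0[OF linear_cross_matrix] linear_add[OF linear_cross_matrix]
  linear_scale[OF linear_cross_matrix] linear_diff[OF linear_cross_matrix] linear_neg[OF linear_cross_matrix]
lemmas contraction_linear = linear_0[OF linear_contraction] linear_add[OF linear_contraction]
  linear_scale[OF linear_contraction] linear_diff[OF linear_contraction] linear_neg[OF linear_contraction]
lemmas trace_linear = linear_0[OF linear_trace] linear_add[OF linear_trace]
  linear_scale[OF linear_trace] linear_diff[OF linear_trace] linear_neg[OF linear_trace]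
lemmas transpose_linear = linear_0[OF linear_transpose] linear_add[OF linear_transpose]
  linear_scale[OF linear_transpose] linear_diff[OF linear_transpose] linear_neg[OF linear_transpose]

text \<open>The element of \<open>W\<close> with components \<open>c I\<close>, \<open>v\<close>, \<open>X(u)\<close>, \<open>S\<close>, \<open>Y\<close> in the five summands.\<close>

definition assemble :: "real \<Rightarrow> real^7 \<Rightarrow> real^7 \<Rightarrow> real^7^7 \<Rightarrow> real^7^7 \<Rightarrow> coords" where
  "assemble c v u S Y = (v, c *\<^sub>R mat 1 + cross_matrix u + S + Y)"

definition is_14_27 :: "real^7^7 \<Rightarrow> real^7^7 \<Rightarrow> bool" where
  "is_14_27 S Y \<longleftrightarrow> transpose S = - S \<and> contraction S = 0 \<and> transpose Y = Y \<and> trace Y = 0"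

text \<open>The trace and the contraction determine \<open>c\<close> and \<open>u\<close>; what is left of the skew and of the symmetric part of the
  matrix after subtracting \<open>X(u)\<close> and \<open>c I\<close> is in the 14- and the 27-dimensional summand.\<close>

lemma assemble_exhaust:
  obtains c v u S Y where "is_14_27 S Y" "m = assemble c v u S Y"
proof -
  obtain v A where m: "m = (v, A)" by (cases m)
  define c where "c = trace A / 7"
  define u where "u = (1/6) *\<^sub>R contraction A"
  define S where "S = (1/2) *\<^sub>R (A - transpose A) - cross_matrix u"
  define Y where "Y = (1/2) *\<^sub>R (A + transpose A) - c *\<^sub>R mat 1"
  have "is_14_27 S Y"
    by (simp add: is_14_27_def S_def Y_def u_def c_def transpose_linear contraction_linear trace_linear trace_transpose
        contraction_transpose transpose_cross_matrix contraction_cross_matrix trace_mat_1 algebra_simps scaleR_2[symmetric])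
  moreover have "m = assemble c v u S Y"
    by (simp add: m assemble_def S_def Y_def vec_eq_iff field_simps)
  ultimately show thesis by (rule that)
qed

text \<open>The operator \<open>h\<close> depends on the matrix through these three expressions only; they also recover \<open>c\<close>, \<open>u\<close>, \<open>S\<close>.\<close>

lemma assemble_projections:
  assumes "is_14_27 S Y"
  shows "trace (snd (assemble c v u S Y)) = 7 * c" "contraction (snd (assemble c v u S Y)) = 6 *\<^sub>R u"
    "snd (assemble c v u S Y) - transpose (snd (assemble c v u S Y)) = 2 *\<^sub>R cross_matrix u + 2 *\<^sub>R S"
  using assms
  by (simp_all add: is_14_27_def assemble_def trace_linear contraction_linear transpose_linear trace_mat_1 trace_skew
      transpose_cross_matrix contraction_cross_matrix contraction_symmetric scaleR_2)

lemma assemble_eq_iff: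
  assumes "is_14_27 S Y" "is_14_27 S' Y'"
  shows "assemble c v u S Y = assemble c' v' u' S' Y' \<longleftrightarrow> c = c' \<and> v = v' \<and> u = u' \<and> S = S' \<and> Y = Y'"
proof
  assume eq: "assemble c v u S Y = assemble c' v' u' S' Y'"
  note p = assemble_projections[OF assms(1), of c v u] and p' = assemble_projections[OF assms(2), of c' v' u']
  have 1: "c = c'" using p(1) p'(1) eq by simp
  have 2: "u = u'" using p(2) p'(2) eq by simp
  have 3: "S = S'" using p(3) p'(3) eq 2 by simp
  show "c = c' \<and> v = v' \<and> u = u' \<and> S = S' \<and> Y = Y'" using eq 1 2 3 by (simp add: assemble_def)
qed simp

lemma h_coords_assemble:
  assumes "is_14_27 S Y"
  shows "h_coords (assemble c v u S Y) = assemble (-7 * c) (- v + 6 *\<^sub>R u) (v + 2 *\<^sub>R u) (-4 *\<^sub>R S) 0"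
proof -
  have "fst (assemble c v u S Y) = v" by (simp add: assemble_def)
  then show ?thesis
    unfolding h_coords_def assemble_projections[OF assms]
    by (simp add: assemble_def cross_matrix_linear algebra_simps flip: scaleR_add_left)
qed

lemma scaleR_assemble: "r *\<^sub>R assemble c v u S Y = assemble (r * c) (r *\<^sub>R v) (r *\<^sub>R u) (r *\<^sub>R S) (r *\<^sub>R Y)"
  by (simp add: assemble_def cross_matrix_linear scaleR_add_right)

lemma is_14_27_scaleR: "is_14_27 S Y \<Longrightarrow> is_14_27 (r *\<^sub>R S) (s *\<^sub>R Y)"
  by (simp add: is_14_27_def transpose_linear contraction_linear trace_linear)

lemma is_14_27_0: "is_14_27 0 0" by (simp add: is_14_27_def transpose_linear contraction_linear trace_linear)

lemma h_coords_assemble_eigen: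
  assumes "is_14_27 S Y"
  shows "h_coords (assemble c v u S Y) = l *\<^sub>R assemble c v u S Y \<longleftrightarrow>
    (l + 7) * c = 0 \<and> - v + 6 *\<^sub>R u = l *\<^sub>R v \<and> v + 2 *\<^sub>R u = l *\<^sub>R u \<and> (l + 4) *\<^sub>R S = 0 \<and> l *\<^sub>R Y = 0"
proof -
  have v: "is_14_27 (-4 *\<^sub>R S) 0" "is_14_27 (l *\<^sub>R S) (l *\<^sub>R Y)"
    using is_14_27_scaleR[OF assms, of "-4" 0] is_14_27_scaleR[OF assms, of l l] by simp_all
  have "(-4) *\<^sub>R S = l *\<^sub>R S \<longleftrightarrow> (l + 4) *\<^sub>R S = 0"
    unfolding scaleR_cancel_right scaleR_eq_0_iff by auto
  then show ?thesis
    unfolding h_coords_assemble[OF assms] scaleR_assemble assemble_eq_iff[OF v] by (auto simp: algebra_simps)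
qed

lemma coords_as_assemble:
  "x \<in> coords_1 \<longleftrightarrow> (\<exists>c. x = assemble c 0 0 0 0)"
  "x \<in> coords_7 \<longleftrightarrow> (\<exists>v. x = assemble 0 v 0 0 0)"
  "x \<in> coords_7' \<longleftrightarrow> (\<exists>u. x = assemble 0 0 u 0 0)"
  "x \<in> coords_14 \<longleftrightarrow> (\<exists>S. is_14_27 S 0 \<and> x = assemble 0 0 0 S 0)"
  "x \<in> coords_27 \<longleftrightarrow> (\<exists>Y. is_14_27 0 Y \<and> x = assemble 0 0 0 0 Y)"
  by (auto simp: coords_1_def coords_7_def coords_7'_def coords_14_def coords_27_def assemble_def cross_matrix_linear
     is_14_27_def transpose_linear contraction_linear trace_linear)

lemma is_14_27_parts: "is_14_27 S Y \<Longrightarrow> is_14_27 S 0" "is_14_27 S Y \<Longrightarrow> is_14_27 0 Y"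
  using is_14_27_scaleR[of S Y 1 0] is_14_27_scaleR[of S Y 0 1] by simp_all

lemma assemble_mem_iff:
  assumes "is_14_27 S Y"
  shows "assemble c v u S Y \<in> coords_1 \<longleftrightarrow> v = 0 \<and> u = 0 \<and> S = 0 \<and> Y = 0"
    "assemble c v u S Y \<in> coords_14 \<longleftrightarrow> c = 0 \<and> v = 0 \<and> u = 0 \<and> Y = 0"
    "assemble c v u S Y \<in> coords_27 \<longleftrightarrow> c = 0 \<and> v = 0 \<and> u = 0 \<and> S = 0"
  using assemble_eq_iff[OF assms] is_14_27_0 is_14_27_parts[OF assms] unfolding coords_as_assemble by blast+

text \<open>Substituting \<open>v = (l - 2) u\<close> into the first equation leaves the characteristic polynomial of the \<open>2 \<times> 2\<close>
  matrix as a factor of \<open>u\<close>.\<close>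

lemma eigen_77_iff:
  fixes u v :: "'a::real_vector"
  shows "- v + 6 *\<^sub>R u = l *\<^sub>R v \<and> v + 2 *\<^sub>R u = l *\<^sub>R u \<longleftrightarrow> v = (l - 2) *\<^sub>R u \<and> (l * l - l - 8 = 0 \<or> u = 0)"
proof -
  have 1: "v + 2 *\<^sub>R u = l *\<^sub>R u \<longleftrightarrow> v = (l - 2) *\<^sub>R u" by (simp add: scaleR_left_diff_distrib eq_diff_eq)
  have 2: "- v + 6 *\<^sub>R u = l *\<^sub>R v \<longleftrightarrow> (l * l - l - 8) *\<^sub>R u = 0" if "v = (l - 2) *\<^sub>R u"
  proof -
    have "l *\<^sub>R v - (- v + 6 *\<^sub>R u) = (l * (l - 2)) *\<^sub>R u + (l - 2) *\<^sub>R u - 6 *\<^sub>R u"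
      by (simp add: that)
    also have "\<dots> = (l * (l - 2) + (l - 2) - 6) *\<^sub>R u"
      by (simp only: scaleR_left_distrib scaleR_left_diff_distrib)
    also have "l * (l - 2) + (l - 2) - 6 = l * l - l - 8" by (simp add: algebra_simps)
    finally have "l *\<^sub>R v - (- v + 6 *\<^sub>R u) = (l * l - l - 8) *\<^sub>R u" .
    then show ?thesis by (metis right_minus_eq)
  qed
  show ?thesis using 1 2 by (metis scaleR_eq_0_iff)
qed

lemma eigenspace_h_coords_mem:
  assumes "is_14_27 S Y"
  shows "assemble c v u S Y \<in> eigenspace h_coords l \<longleftrightarrow>
    (l = - 7 \<or> c = 0) \<and> v = (l - 2) *\<^sub>R u \<and> (l * l - l - 8 = 0 \<or> u = 0) \<and> (l = - 4 \<or> S = 0) \<and> (l = 0 \<or> Y = 0)"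
proof -
  have "l + 7 = 0 \<longleftrightarrow> l = - 7" "l + 4 = 0 \<longleftrightarrow> l = - 4" by auto
  then show ?thesis
    unfolding eigenspace_def mem_Collect_eq h_coords_assemble_eigen[OF assms]
    using eigen_77_iff[of v u l] by auto
qed

lemma eigenspace_h_coords:
  "eigenspace h_coords (-7) = coords_1" "eigenspace h_coords (-4) = coords_14" "eigenspace h_coords 0 = coords_27"
  "l * l - l - 8 = 0 \<Longrightarrow> eigenspace h_coords l = range (\<lambda>u. ((l - 2) *\<^sub>R u, cross_matrix u))"
  "l \<notin> {-7, -4, 0} \<Longrightarrow> l * l - l - 8 \<noteq> 0 \<Longrightarrow> eigenspace h_coords l = {0}"
proof -
  have ext: "A = B" if "\<And>c v u S Y. is_14_27 S Y \<Longrightarrow> assemble c v u S Y \<in> A \<longleftrightarrow> assemble c v u S Y \<in> B" for A B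
    using that assemble_exhaust by (metis set_eqI)
  show "eigenspace h_coords (-7) = coords_1" "eigenspace h_coords (-4) = coords_14" "eigenspace h_coords 0 = coords_27"
    by (rule ext; force simp: eigenspace_h_coords_mem assemble_mem_iff)+
  have "assemble 0 0 0 0 0 = 0" by (simp add: assemble_def cross_matrix_linear zero_prod_def)
  then have "assemble c v u S Y = 0 \<longleftrightarrow> c = 0 \<and> v = 0 \<and> u = 0 \<and> S = 0 \<and> Y = 0" if "is_14_27 S Y" for c v u S Y
    using assemble_eq_iff[OF that is_14_27_0, of c v u 0 0 0] by simp
  then show "eigenspace h_coords l = {0}" if "l \<notin> {-7, -4, 0}" "l * l - l - 8 \<noteq> 0"
    using that by (intro ext) (auto simp: eigenspace_h_coords_mem)
  show "eigenspace h_coords l = range (\<lambda>u. ((l - 2) *\<^sub>R u, cross_matrix u))" if l: "l * l - l - 8 = 0"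
  proof (rule ext)
    fix c v u S Y assume is_14_27: "is_14_27 S Y"
    have ne: "l \<noteq> -7" "l \<noteq> -4" "l \<noteq> 0" using l by auto
    have "((l - 2) *\<^sub>R u, cross_matrix u) = assemble 0 ((l - 2) *\<^sub>R u) u 0 0" for u
      by (simp add: assemble_def)
    then show "assemble c v u S Y \<in> eigenspace h_coords l \<longleftrightarrow> assemble c v u S Y \<in> range (\<lambda>u. ((l - 2) *\<^sub>R u, cross_matrix u))"
      using ne l by (auto simp: eigenspace_h_coords_mem[OF is_14_27] image_iff assemble_eq_iff[OF is_14_27 is_14_27_0])
  qed
qed

lemma coords_direct_sum:
  "direct_sum_decomposition [coords_1, coords_7, coords_7', coords_14, coords_27]"
  unfolding direct_sum_decomposition_def
proof (intro conjI ballI allI)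
  show "subspace U" if "U \<in> set [coords_1, coords_7, coords_7', coords_14, coords_27]" for U
    using that coords_submodules[THEN G2_invariantD(1)] by auto
  fix m :: coords
  obtain c v u S Y where is_14_27: "is_14_27 S Y" and m: "m = assemble c v u S Y" by (rule assemble_exhaust)
  note vS = is_14_27_parts[OF is_14_27]
  let ?Us = "[coords_1, coords_7, coords_7', coords_14, coords_27]"
  have sum: "sum_list [assemble c 0 0 0 0, assemble 0 v 0 0 0, assemble 0 0 u 0 0, assemble 0 0 0 S 0, assemble 0 0 0 0 Y] = assemble c v u S Y"
    for c v u S Y by (simp add: assemble_def cross_matrix_linear add.assoc)
  show "\<exists>!ws. list_all2 (\<in>) ws ?Us \<and> m = sum_list ws"
  proof (rule ex1I[of _ "[assemble c 0 0 0 0, assemble 0 v 0 0 0, assemble 0 0 u 0 0, assemble 0 0 0 S 0, assemble 0 0 0 0 Y]"])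
    show "list_all2 (\<in>) [assemble c 0 0 0 0, assemble 0 v 0 0 0, assemble 0 0 u 0 0, assemble 0 0 0 S 0, assemble 0 0 0 0 Y] ?Us \<and>
      m = sum_list [assemble c 0 0 0 0, assemble 0 v 0 0 0, assemble 0 0 u 0 0, assemble 0 0 0 S 0, assemble 0 0 0 0 Y]"
      unfolding sum m using vS by (auto simp: coords_as_assemble)
    fix ws assume ws: "list_all2 (\<in>) ws ?Us \<and> m = sum_list ws"
    then obtain c' v' u' S' Y' where w: "ws = [assemble c' 0 0 0 0, assemble 0 v' 0 0 0, assemble 0 0 u' 0 0, assemble 0 0 0 S' 0, assemble 0 0 0 0 Y']"
       and "is_14_27 S' 0" "is_14_27 0 Y'"
      by (auto simp: list_all2_Cons2 coords_as_assemble)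
    then have valid': "is_14_27 S' Y'" by (simp add: is_14_27_def)
    have "assemble c v u S Y = assemble c' v' u' S' Y'" using ws unfolding w sum m by simp
    then show "ws = [assemble c 0 0 0 0, assemble 0 v 0 0 0, assemble 0 0 u 0 0, assemble 0 0 0 S 0, assemble 0 0 0 0 Y]"
      unfolding w assemble_eq_iff[OF is_14_27 valid'] by simp
  qed
qed

lemma dim_range_inj:
  fixes f :: "'a::euclidean_space \<Rightarrow> 'b::real_vector"
  assumes "linear f" "inj f" shows "dim (range f) = DIM('a)"
  using dim_image_eq[OF assms(1), of UNIV] assms(2) by simp

lemma inj_cross_matrix: "inj cross_matrix"
proof (rule injI)
  fix u u' assume "cross_matrix u = cross_matrix u'"
  then have "contraction (cross_matrix u) = contraction (cross_matrix u')" by simp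
  then show "u = u'" by (simp add: contraction_cross_matrix)
qed

lemma dim_small:
  "dim coords_1 = 1" "dim coords_7 = 7" "dim coords_7' = 7"
  "dim (range (\<lambda>u. (r *\<^sub>R u, cross_matrix u))) = 7"
proof -
  show "dim coords_1 = 1"
    unfolding coords_1_def by (subst dim_range_inj) (auto simp: linear_iff algebra_simps inj_def mat_def vec_eq_iff)
  show "dim coords_7 = 7"
    unfolding coords_7_def by (subst dim_range_inj) (auto simp: linear_iff inj_def)
  show "dim coords_7' = 7"
    unfolding coords_7'_def by (subst dim_range_inj) (auto simp: linear_iff cross_matrix_linear inj_def dest: injD[OF inj_cross_matrix])
  show "dim (range (\<lambda>u. (r *\<^sub>R u, cross_matrix u))) = 7"
    by (subst dim_range_inj) (auto simp: linear_iff cross_matrix_linear inj_def algebra_simps dest: injD[OF inj_cross_matrix])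
qed

lemma eq_0_if_parts_0:
  assumes "diag_part m = 0" "\<And>k. weight_part (mat_act (shift k) m) = 0"
  shows "m = 0"
proof -
  have "G2_invariant {0 :: coords}"
    by (simp add: G2_invariant_def linear_0[OF linear_mat_act])
  from in_invariantI[OF this] assms show ?thesis by simp
qed

text \<open>A skew matrix of this summand is determined by two entries for each of the seven weights, the third one being
  minus their sum.\<close>

lemma dim_coords_14_le: "dim coords_14 \<le> 14"
proof -
  let ?f = "\<lambda>m :: coords. (\<chi> k. snd m $ (1+k) $ (3+k), \<chi> k. snd m $ (2+k) $ (6+k)) :: (real^7) \<times> (real^7)"
  have f: "linear ?f" by (simp add: linear_iff vec_eq_iff)
  have sub: "subspace coords_14" using coords_submodules[THEN G2_invariantD(1)] by simp
  have "m = 0" if m: "m \<in> coords_14" "?f m = 0" for m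
  proof (rule eq_0_if_parts_0)
    show "diag_part m = 0" using m(1) by (rule diag_part_coords_14)
    fix k
    obtain A where A: "m = (0, A)" "transpose A = (-1) *\<^sub>R A" using m(1) by (auto simp: coords_14_def)
    have "A $ (1+k) $ (3+k) = 0" "A $ (2+k) $ (6+k) = 0"
      using m(2) by (simp_all add: A zero_prod_def vec_eq_iff)
    then have w: "weight_part (mat_act (shift k) m) = (0, line_matrix (-1) 0 0 (A $ (4+k) $ (5+k)))"
      using weight_part_shift_line[OF A(2), of k] by (simp add: A)
    have "weight_part (mat_act (shift k) m) \<in> coords_14"
      by (intro parts_in_invariant G2_invariantD(6) coords_submodules shift_in_G2 m)
    from line_matrix_coords_14[OF this[unfolded w]] show "weight_part (mat_act (shift k) m) = 0"
      unfolding w by (simp add: line_matrix_eq_0 zero_prod_def)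
  qed
  then have "inj_on ?f coords_14"
    using linear_inj_on_iff_eq_0[OF f sub] by blast
  then have "inj_on ?f (span coords_14)" using sub by (simp only: span_eq_iff[THEN iffD2])
  then have "dim coords_14 = dim (?f ` coords_14)" by (rule dim_image_eq[OF f, symmetric])
  also have "\<dots> \<le> DIM((real^7) \<times> (real^7))" by (rule dim_subset_UNIV)
  finally show ?thesis by simp
qed

text \<open>A symmetric matrix is determined by its diagonal and by three entries for each of the seven weights; the
  trace condition restricts these 28 numbers to a hyperplane.\<close>

lemma dim_coords_27_le: "dim coords_27 \<le> 27"
proof -
  let ?f = "\<lambda>m :: coords. (\<chi> k. snd m $ k $ k, \<chi> k. snd m $ (1+k) $ (3+k), \<chi> k. snd m $ (2+k) $ (6+k),
     \<chi> k. snd m $ (4+k) $ (5+k)) :: (real^7) \<times> (real^7) \<times> (real^7) \<times> (real^7)"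
  have f: "linear ?f" by (simp add: linear_iff vec_eq_iff)
  have sub: "subspace coords_27" using coords_submodules[THEN G2_invariantD(1)] by simp
  have "m = 0" if m: "m \<in> coords_27" "?f m = 0" for m
  proof (rule eq_0_if_parts_0)
    obtain A where A: "m = (0, A)" "transpose A = 1 *\<^sub>R A" using m(1) by (auto simp: coords_27_def)
    have 0: "A $ k $ k = 0" "A $ (1+k) $ (3+k) = 0" "A $ (2+k) $ (6+k) = 0" "A $ (4+k) $ (5+k) = 0" for k
      using m(2) by (simp_all add: A zero_prod_def vec_eq_iff)
    then show "diag_part m = 0" by (simp add: A diag_part_def zero_prod_def vec_eq_iff)
    show "weight_part (mat_act (shift k) m) = 0" for k
      unfolding A(1) weight_part_shift_line[OF A(2)] 0 line_matrix_eq_0 by (simp add: zero_prod_def)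
  qed
  then have "inj_on ?f coords_27"
    using linear_inj_on_iff_eq_0[OF f sub] by blast
  then have "inj_on ?f (span coords_27)" using sub by (simp only: span_eq_iff[THEN iffD2])
  then have "dim coords_27 = dim (?f ` coords_27)" by (rule dim_image_eq[OF f, symmetric])
  also have "\<dots> \<le> dim {x :: (real^7) \<times> (real^7) \<times> (real^7) \<times> (real^7). (1, 0) \<bullet> x = 0}"
    by (intro dim_subset) (auto simp: coords_27_def inner_vec_def trace_def)
  also have "\<dots> = 27"
    by (subst dim_hyperplane) (auto simp: zero_prod_def)
  finally show ?thesis .
qed

text \<open>The five dimensions must add up to at least 56, the dimension of the space of coordinates, so both upper
  bounds are attained.\<close>

lemma dim_large: "dim coords_14 = 14" "dim coords_27 = 27"
proof -
  let ?f = "\<lambda>(x1 :: coords, x2 :: coords, x3 :: coords, x4 :: coords, x5 :: coords). x1 + x2 + x3 + x4 + x5"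
  let ?P = "coords_1 \<times> coords_7 \<times> coords_7' \<times> coords_14 \<times> coords_27"
  note sub = coords_submodules[THEN G2_invariantD(1)]
  have f: "linear ?f" by (simp add: linear_iff algebra_simps split: prod.split)
  have "m \<in> ?f ` ?P" for m
  proof -
    obtain c v u S Y where is_14_27: "is_14_27 S Y" and m: "m = assemble c v u S Y" by (rule assemble_exhaust)
    have "((0, c *\<^sub>R mat 1), (v, 0), (0, cross_matrix u), (0, S), (0, Y)) \<in> ?P"
      using is_14_27 by (auto simp: coords_1_def coords_7_def coords_7'_def coords_14_def coords_27_def is_14_27_def)
    moreover have "m = ?f ((0, c *\<^sub>R mat 1), (v, 0), (0, cross_matrix u), (0, S), (0, Y))"
      by (simp add: m assemble_def)
    ultimately show ?thesis by (rule rev_image_eqI)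
  qed
  then have "?f ` ?P = UNIV" by blast
  then have "DIM(coords) \<le> dim ?P" using dim_image_le[OF f, of ?P] by simp
  also have "\<dots> = 1 + (7 + (7 + (dim coords_14 + dim coords_27)))"
    using sub by (simp add: dim_Times subspace_Times dim_small)
  finally show "dim coords_14 = 14" "dim coords_27 = 27"
    using dim_coords_14_le dim_coords_27_le by simp_all
qed

section \<open>Coordinates on the tensor product\<close>

lemma bilinear_omult: "bilinear (\<cdot>)"
  unfolding bilinear_def linear_iff omult_def
  by (simp add: bilinear_ladd[OF im_cross_bilinear] bilinear_radd[OF im_cross_bilinear]
      bilinear_lmul[OF im_cross_bilinear] bilinear_rmul[OF im_cross_bilinear] inner_add_left inner_add_right
      algebra_simps)

lemma im_cross_cyclic: "im_cross a b \<bullet> c = a \<bullet> im_cross b c"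
  by (simp add: im_cross_def inner_vec_def sum_7 numerals_mod_7 algebra_simps)

lemma orthogonalD:
  fixes F :: "real^'n^'n"
  assumes "orthogonal_matrix F"
  shows "transpose F ** F = mat 1" "F ** transpose F = mat 1" "transpose F *v (F *v x) = x"
    "F *v (transpose F *v x) = x" "(F *v x) \<bullet> (F *v y) = x \<bullet> y"
proof -
  show 1: "transpose F ** F = mat 1" "F ** transpose F = mat 1"
    using assms by (simp_all add: orthogonal_matrix_def)
  show 2: "transpose F *v (F *v x) = x" "F *v (transpose F *v x) = x" for x
    by (simp_all only: matrix_vector_mul_assoc 1 matrix_vector_mul_lid)
  show "(F *v x) \<bullet> (F *v y) = x \<bullet> y"
    using 2(1)[of y] by (metis dot_lmul_matrix inner_commute transpose_matrix_vector)
qed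

text \<open>The data of the theorem that do not involve the basis. Everything is compared with the standard basis of the
  imaginary octonions through the isomorphism \<open>of_coords\<close> from coordinates onto \<open>W\<close>.\<close>

locale octonion_tensor =
  fixes hat :: "'v::euclidean_space \<Rightarrow> octonion"
    and t :: "octonion \<Rightarrow> 'v \<Rightarrow> 'w::real_vector"
  assumes hat: "isometric_identification hat" and t: "is_tensor_product t"
begin

definition of_im :: "real^7 \<Rightarrow> 'v" where "of_im x = inv hat (0, x)"

definition im :: "'v \<Rightarrow> real^7" where "im v = snd (hat v)"

lemma linear_hat: "linear hat" and hat_inner: "hat u \<bullet> hat v = u \<bullet> v" and range_hat: "range hat = ImO"
  using hat by (auto simp: isometric_identification_def)

lemma inj_hat: "inj hat"
  by (metis (mono_tags, opaque_lifting) hat_inner inner_eq_zero_iff linear_hat linear_injective_0)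

lemma hat_eq: "hat v = (0, im v)"
  using range_hat by (auto simp: ImO_def im_def prod_eq_iff)

lemma im_of_im [simp]: "im (of_im x) = x"
proof -
  have "(0, x) \<in> range hat" by (simp add: range_hat ImO_def)
  then have "hat (of_im x) = (0, x)" by (simp add: of_im_def f_inv_into_f)
  then show ?thesis by (simp add: im_def)
qed

lemma of_im_im [simp]: "of_im (im v) = v"
  unfolding of_im_def hat_eq[symmetric] by (rule inv_f_f[OF inj_hat])

lemma inv_hat: "inv hat (0, x) = of_im x" by (simp add: of_im_def)

lemma linear_im: "linear im"
  using linear_hat unfolding linear_iff im_def by simp

lemma linear_of_im: "linear of_im"
  unfolding linear_iff
  by (metis im_of_im of_im_im linear_add[OF linear_im] linear_scale[OF linear_im])

lemma im_inner: "im u \<bullet> im v = u \<bullet> v"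
  using hat_inner[of u v] by (simp add: hat_eq)

lemma t_linear: "linear (\<lambda>x. t x v)" "linear (t x)" and bilinear_t: "bilinear t"
  using t unfolding is_tensor_product_def bilinear_def by blast+

definition of_coords :: "coords \<Rightarrow> 'w" where
  "of_coords m = (\<Sum>j\<in>UNIV. t (fst m $ j, column j (snd m)) (of_im (axis j 1)))"

lemma linear_of_coords: "linear of_coords"
proof -
  have "of_coords m = (\<Sum>j\<in>UNIV. t (fst m $ j, snd m *v axis j 1) (of_im (axis j 1)))" for m
    by (simp add: of_coords_def matrix_vector_mult_basis)
  moreover have "linear (\<lambda>m. \<Sum>j\<in>UNIV. t (fst m $ j, snd m *v axis j 1) (of_im (axis j 1)))"
  proof (intro linear_compose_sum ballI)
    fix j :: 7
    have "linear (\<lambda>m :: coords. (fst m $ j, snd m *v axis j 1))"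
      by (simp add: linear_iff matrix_vector_mult_add_rdistrib scaleR_matrix_vector_assoc)
    from linear_compose[OF this t_linear(1)]
    show "linear (\<lambda>m. t (fst m $ j, snd m *v axis j 1) (of_im (axis j 1)))" by (simp add: o_def)
  qed
  ultimately show ?thesis by presburger
qed

text \<open>The element \<open>of_coords (v, A)\<close> has the same expression in every orthonormal basis \<open>f\<close>, namely
  \<open>\<Sum>j. (\<langle>v, f\<^sub>j\<rangle> 1 + A f\<^sub>j) \<otimes> f\<^sub>j\<close>.\<close>

lemma of_coords_orthogonal:
  assumes F: "orthogonal_matrix F"
  shows "of_coords (v, A) = (\<Sum>j\<in>UNIV. t (v \<bullet> (F *v axis j 1), A *v (F *v axis j 1)) (of_im (F *v axis j 1)))"
proof -
  let ?B = "\<lambda>x y. t (v \<bullet> x, A *v x) (of_im y)"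
  have "bilinear ?B"
    unfolding bilinear_def
  proof (intro conjI allI)
    show "linear (?B x)" for x
      using linear_compose[OF linear_of_im t_linear(2)] by (simp add: o_def)
    have "linear (\<lambda>x. (v \<bullet> x, A *v x))"
      by (simp add: linear_iff inner_add_right matrix_vector_right_distrib matrix_vector_mult_scaleR)
    from linear_compose[OF this t_linear(1)] show "linear (\<lambda>x. ?B x y)" for y by (simp add: o_def)
  qed
  from orthogonal_sum_bilinear[OF this F] show ?thesis
    by (simp add: of_coords_def matrix_vector_mult_basis inner_axis)
qed

text \<open>The universal property provides a linear map from \<open>W\<close> back to seven octonions, the coefficients of the basis
  vectors in the second tensor factor.\<close>

lemma inj_of_coords: "inj of_coords"
proof -
  let ?B = "\<lambda>(x :: octonion) v. (\<chi> j. im v $ j *\<^sub>R x) :: octonion^7"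
  have "bilinear ?B"
    unfolding bilinear_def linear_iff
    by (simp add: vec_eq_iff linear_add[OF linear_im] linear_scale[OF linear_im] scaleR_add_left scaleR_add_right mult.commute)
  from is_tensor_product_lift[OF t this]
  obtain L where L: "linear L" "\<And>x v. L (t x v) = ?B x v" by blast
  have *: "L (of_coords m) $ j = (fst m $ j, column j (snd m))" for m j
  proof -
    have "L (of_coords m) $ j = (\<Sum>i\<in>UNIV. axis i 1 $ j *\<^sub>R (fst m $ i, column i (snd m)))"
      unfolding of_coords_def linear_sum[OF L(1)] L(2) by simp
    also have "\<dots> = (\<Sum>i\<in>UNIV. if i = j then (fst m $ i, column i (snd m)) else 0)"
      by (rule sum.cong) (auto simp: axis_def zero_prod_def)
    finally show ?thesis by simp
  qed
  show ?thesis
  proof (rule injI)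
    fix m n assume "of_coords m = of_coords n"
    then have "(fst m $ j, column j (snd m)) = (fst n $ j, column j (snd n))" for j
      using *[of m j] *[of n j] by simp
    then show "m = n" by (simp add: prod_eq_iff vec_eq_iff column_def)
  qed
qed

text \<open>The range contains every pure tensor, and these span \<open>W\<close>.\<close>

lemma surj_of_coords: "surj of_coords"
proof -
  have "t x v \<in> range of_coords" for x v
  proof -
    have "im v = (\<Sum>j\<in>UNIV. im v $ j *\<^sub>R axis j 1)"
      using basis_expansion[of "im v"] by (simp add: scalar_mult_eq_scaleR)
    then have "v = (\<Sum>j\<in>UNIV. im v $ j *\<^sub>R of_im (axis j 1))"
      by (metis (no_types, lifting) of_im_im linear_sum[OF linear_of_im] linear_scale[OF linear_of_im] sum.cong)
    then have "t x v = (\<Sum>j\<in>UNIV. im v $ j *\<^sub>R t x (of_im (axis j 1)))"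
      by (metis (no_types, lifting) linear_sum[OF t_linear(2)] linear_scale[OF t_linear(2)] sum.cong)
    also have "\<dots> = (\<Sum>j\<in>UNIV. t (im v $ j *\<^sub>R x) (of_im (axis j 1)))"
      by (simp only: linear_scale[OF t_linear(1)])
    also have "\<dots> = of_coords (fst x *\<^sub>R im v, \<chi> i j. snd x $ i * im v $ j)"
    proof -
      have "im v $ j *\<^sub>R x = (fst x * im v $ j, column j (\<chi> i j. snd x $ i * im v $ j))" for j
        by (simp add: prod_eq_iff vec_eq_iff column_def)
      then show ?thesis by (simp add: of_coords_def)
    qed
    finally show ?thesis by blast
  qed
  then have "range (case_prod t) \<subseteq> range of_coords" by auto
  moreover have "subspace (range of_coords)" by (rule linear_subspace_image[OF linear_of_coords subspace_UNIV])
  ultimately show ?thesis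
    using is_tensor_product_span[OF t] span_minimal by blast
qed

text \<open>The columns are the vectors \<open>e\<^sub>j\<close>, viewed as imaginary octonions.\<close>

definition frame :: "(7 \<Rightarrow> 'v) \<Rightarrow> real^7^7" where "frame e = (\<chi> i j. im (e j) $ i)"

lemma frame_axis: "frame e *v axis j 1 = im (e j)"
  by (simp add: matrix_vector_mult_basis column_def frame_def)

lemma orthogonal_frame:
  assumes "orthonormal_basis e" shows "orthogonal_matrix (frame e)"
proof -
  have "(transpose (frame e) ** frame e) $ i $ j = im (e i) \<bullet> im (e j)" for i j
    by (simp add: matrix_matrix_mult_def transpose_def frame_def inner_vec_def)
  then have "transpose (frame e) ** frame e = mat 1"
    using assms by (simp add: im_inner orthonormal_basis_def vec_eq_iff mat_def)
  then show ?thesis by (simp add: orthogonal_matrix)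
qed

lemma frame_mult: "frame e *v x = (\<Sum>j\<in>UNIV. x $ j *\<^sub>R im (e j))"
  by (simp add: frame_def matrix_vector_mult_def vec_eq_iff mult.commute)

text \<open>Coordinates with respect to \<open>e\<close> and with respect to the standard basis differ by the action of the orthogonal
  matrix \<open>frame e\<close>, which in general does not preserve the cross product.\<close>

lemma elem_W_eq_of_coords:
  assumes "orthonormal_basis e"
  shows "elem_W hat e t a w = of_coords (frame e *v (\<chi> j. a j), frame e ** (\<chi> i j. w i j) ** transpose (frame e))"
proof -
  let ?F = "frame e"
  note F = orthogonal_frame[OF assms]
  have "(\<chi> i j. w i j) *v axis j 1 = (\<chi> i. w i j)" for j
    by (simp add: matrix_vector_mult_basis column_def)
  then have "(?F ** (\<chi> i j. w i j) ** transpose ?F) *v (?F *v axis j 1) = (\<Sum>i\<in>UNIV. w i j *\<^sub>R im (e i))" for j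
    using frame_mult[of e "\<chi> i. w i j"]
    by (simp add: matrix_vector_mul_assoc[symmetric] orthogonalD(3)[OF F] del: transpose_matrix_vector)
  moreover have "(?F *v (\<chi> j. a j)) \<bullet> (?F *v axis j 1) = a j" for j
    by (simp add: orthogonalD(5)[OF F] inner_axis)
  moreover have "a j *\<^sub>R oone + (\<Sum>i\<in>UNIV. w i j *\<^sub>R hat (e i)) = (a j, \<Sum>i\<in>UNIV. w i j *\<^sub>R im (e i))" for j
    by (simp add: oone_def hat_eq prod_eq_iff fst_sum snd_sum)
  ultimately show ?thesis
    unfolding elem_W_def of_coords_orthogonal[OF F] by (simp add: frame_axis)
qed

text \<open>Both the inner and the outer sum in the definition of \<open>h\<close> are sums over an orthonormal basis of bilinear
  expressions, so \<open>e\<close> may be replaced by the standard basis in each of them.\<close>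

lemma h_of_coords:
  fixes h :: "'w \<Rightarrow> 'w"
  assumes e: "orthonormal_basis e"
    and h: "\<And>w :: 7 \<Rightarrow> octonion. h (\<Sum>j\<in>UNIV. t (w j) (e j)) =
           (\<Sum>i\<in>UNIV. t (\<Sum>j\<in>UNIV. (hat (e i) \<cdot> hat (e j)) \<cdot> w j) (e i))"
  shows "h (of_coords m) = of_coords (h_coords m)"
proof -
  obtain v A where m: "m = (v, A)" by (cases m)
  let ?F = "frame e"
  note F = orthogonal_frame[OF e]
  define K where "K x = (\<Sum>j\<in>UNIV. ((0, x) \<cdot> (0, axis j 1)) \<cdot> (v \<bullet> axis j 1, A *v axis j 1))" for x
  have pair: "linear (\<lambda>x. (0 :: real, x :: real^7))" "linear (\<lambda>x. (v \<bullet> x, A *v x))"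
    by (simp_all add: linear_iff inner_add_right matrix_vector_right_distrib matrix_vector_mult_scaleR)
  have om: "linear (\<lambda>x. x \<cdot> y)" "linear (\<lambda>y. x \<cdot> y)" for x y
    using bilinear_omult unfolding bilinear_def by blast+
  have K: "(\<Sum>j\<in>UNIV. ((0, x) \<cdot> (0, ?F *v axis j 1)) \<cdot> (v \<bullet> (?F *v axis j 1), A *v (?F *v axis j 1))) = K x" for x
  proof -
    have "bilinear (\<lambda>y z. ((0, x) \<cdot> (0, y)) \<cdot> (v \<bullet> z, A *v z))"
      unfolding bilinear_def
      using linear_compose[OF linear_compose[OF pair(1) om(2)] om(1)] linear_compose[OF pair(2) om(2)]
      by (simp add: o_def)
    from orthogonal_sum_bilinear[OF this F] show ?thesis by (simp only: K_def)
  qed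
  have "linear K"
    unfolding K_def
    using linear_compose[OF linear_compose[OF pair(1) om(1)] om(1)]
    by (intro linear_compose_sum ballI) (simp add: o_def)
  have "bilinear (\<lambda>x y. t (K x) (of_im y))"
    unfolding bilinear_def
    using linear_compose[OF \<open>linear K\<close> t_linear(1)] linear_compose[OF linear_of_im t_linear(2)]
    by (simp add: o_def)
  from orthogonal_sum_bilinear[OF this F]
  have K2: "(\<Sum>i\<in>UNIV. t (K (?F *v axis i 1)) (of_im (?F *v axis i 1))) = (\<Sum>i\<in>UNIV. t (K (axis i 1)) (of_im (axis i 1)))" .
  have "h (of_coords m) = (\<Sum>i\<in>UNIV. t (K (?F *v axis i 1)) (of_im (?F *v axis i 1)))"
    unfolding m of_coords_orthogonal[OF F] K[symmetric] using h
    by (simp add: frame_axis hat_eq)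
  also have "\<dots> = of_coords (h_coords m)"
    unfolding K2 m using h_coords_column[of _ v A]
    by (simp add: of_coords_def K_def inner_axis matrix_vector_mult_basis)
  finally show ?thesis .
qed

end

section \<open>Automorphisms acting on the tensor product\<close>

lemma im_cross_self [simp]: "im_cross a a = 0"
  by (simp add: im_cross_def vec_eq_iff mult.commute)

definition G2_of :: "real^7^7 \<Rightarrow> octonion \<Rightarrow> octonion" where
  "G2_of g x = (fst x, g *v snd x)"

lemma G2_of_mem:
  assumes g: "g \<in> G2_matrices" shows "G2_of g \<in> G2"
proof -
  note orth = orthogonalD[OF G2_matricesD(1)[OF g]]
  have "linear (G2_of g)"
    by (simp add: linear_iff G2_of_def matrix_vector_right_distrib matrix_vector_mult_scaleR)
  moreover have "bij (G2_of g)"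
    by (rule bij_betw_byWitness[of _ "G2_of (transpose g)"])
      (auto simp: G2_of_def orth simp del: transpose_matrix_vector)
  moreover have "G2_of g (x \<cdot> y) = G2_of g x \<cdot> G2_of g y" for x y
    by (simp add: G2_of_def omult_def orth G2_matricesD(2)[OF g] matrix_vector_right_distrib matrix_vector_mult_scaleR)
  ultimately show ?thesis by (simp add: G2_def)
qed

text \<open>An automorphism fixes the unit. An imaginary \<open>x\<close> satisfies \<open>x\<^sup>2 = - |x|\<^sup>2\<close>, hence so does its image; an
  octonion whose square is this real number is imaginary, with the same norm as \<open>x\<close>. So the automorphism restricts to an
  isometry of the imaginary octonions, and multiplicativity says that it preserves the cross product.\<close>

lemma G2_obtain_matrix:
  assumes "\<gamma> \<in> G2"
  obtains g where "g \<in> G2_matrices" "\<gamma> = G2_of g"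
proof -
  have lin: "linear \<gamma>" and bij: "bij \<gamma>" and mult: "\<gamma> (x \<cdot> y) = \<gamma> x \<cdot> \<gamma> y" for x y
    using assms unfolding G2_def by blast+
  have one: "\<gamma> oone = oone"
  proof -
    obtain y where y: "\<gamma> y = oone" using bij by (metis bij_pointE)
    then show ?thesis using mult[of oone y] by simp
  qed
  have im: "fst (\<gamma> (0, x)) = 0 \<and> snd (\<gamma> (0, x)) \<bullet> snd (\<gamma> (0, x)) = x \<bullet> x" for x
  proof -
    obtain a b where ab: "\<gamma> (0, x) = (a, b)" by (cases "\<gamma> (0, x)")
    have "(0, x) \<cdot> (0, x) = (- (x \<bullet> x)) *\<^sub>R oone" by (simp add: omult_def oone_def)
    then have "(a, b) \<cdot> (a, b) = (- (x \<bullet> x)) *\<^sub>R oone"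
      using mult[of "(0, x)" "(0, x)"] by (simp add: ab linear_neg[OF lin] linear_scale[OF lin] one)
    then have sq: "a * a - b \<bullet> b = - (x \<bullet> x)" and "snd ((a, b) \<cdot> (a, b)) = 0"
      by (simp_all add: omult_def oone_def)
    then have "2 *\<^sub>R (a *\<^sub>R b) = 0" unfolding scaleR_2 by (simp add: omult_def)
    then have "a = 0 \<or> b = 0" by simp
    moreover have "a = 0" if "b = 0"
    proof -
      have "a * a + x \<bullet> x = 0" using sq that by simp
      then show ?thesis by (metis add_nonneg_eq_0_iff inner_ge_zero mult_eq_0_iff zero_le_square)
    qed
    ultimately have "a = 0" by blast
    with sq show ?thesis by (simp add: ab)
  qed
  define f where "f x = snd (\<gamma> (0, x))" for x
  have f: "\<gamma> (0, x) = (0, f x)" for x using im by (simp add: f_def prod_eq_iff)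
  have "linear f"
    using linear_add[OF lin, of "(0, _)" "(0, _)"] linear_scale[OF lin, of _ "(0, _)"]
    by (simp add: linear_iff f)
  moreover have "norm (f x) = norm x" for x using im by (simp add: f_def norm_eq_sqrt_inner)
  ultimately have orth: "orthogonal_matrix (matrix f)"
    using orthogonal_transformation orthogonal_transformation_matrix by blast
  have mf: "matrix f *v x = f x" for x using \<open>linear f\<close> by simp
  have \<gamma>: "\<gamma> = G2_of (matrix f)"
  proof
    fix x
    have "x = fst x *\<^sub>R oone + (0, snd x)" by (simp add: oone_def prod_eq_iff)
    then have "\<gamma> x = fst x *\<^sub>R \<gamma> oone + \<gamma> (0, snd x)" by (metis linear_add[OF lin] linear_scale[OF lin])
    then show "\<gamma> x = G2_of (matrix f) x" by (simp add: one[unfolded oone_def] f G2_of_def mf oone_def)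
  qed
  have "im_cross (f x) (f y) = f (im_cross x y)" for x y
    using arg_cong[OF mult[of "(0, x)" "(0, y)"], of snd]
    by (simp add: \<gamma> G2_of_def omult_def mf)
  then have "matrix f \<in> G2_matrices" using orth by (simp add: G2_matrices_def mf)
  with \<gamma> show thesis using that by blast
qed

context octonion_tensor
begin

lemma act_V_G2_of: "act_V hat (G2_of g) v = of_im (g *v im v)"
  by (simp add: act_V_def G2_of_def hat_eq inv_hat)

text \<open>The image of \<open>of_coords m\<close> is naturally written in the orthonormal basis \<open>g e\<^sub>j\<close>, to which
  \<open>of_coords_orthogonal\<close> applies.\<close>

lemma act_W_of_coords:
  assumes g: "g \<in> G2_matrices"
  shows "act_W hat t (G2_of g) (of_coords m) = of_coords (mat_act g m)"
proof -
  obtain v A where m: "m = (v, A)" by (cases m)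
  let ?B = "\<lambda>x v. t (G2_of g x) (of_im (g *v im v))"
  have 1: "linear (G2_of g)"
    by (simp add: linear_iff G2_of_def matrix_vector_right_distrib matrix_vector_mult_scaleR)
  have 2: "linear (\<lambda>v. of_im (g *v im v))"
    using linear_compose[OF linear_compose[OF linear_im matrix_vector_mul_linear] linear_of_im] by (simp add: o_def)
  have "bilinear ?B"
    unfolding bilinear_def
    using linear_compose[OF 1 t_linear(1)] linear_compose[OF 2 t_linear(2)] by (simp add: o_def)
  from theI'[OF is_tensor_product_lift[OF t this]]
  have lin: "linear (act_W hat t (G2_of g))"
    and act: "act_W hat t (G2_of g) (t x v) = t (G2_of g x) (of_im (g *v im v))" for x v
    unfolding act_W_def tensor_map_def act_V_G2_of by blast+
  note orth = orthogonalD[OF G2_matricesD(1)[OF g]]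
  have "act_W hat t (G2_of g) (of_coords m) = (\<Sum>j\<in>UNIV. t (v $ j, g *v column j A) (of_im (g *v axis j 1)))"
    unfolding of_coords_def linear_sum[OF lin] act by (simp add: G2_of_def m)
  also have "\<dots> = of_coords (mat_act g m)"
  proof -
    have "(g ** A ** transpose g) *v (g *v axis j 1) = g *v (A *v axis j 1)" for j
      by (simp add: orth matrix_vector_mul_assoc[symmetric] del: transpose_matrix_vector)
    moreover have "(g *v v) \<bullet> (g *v axis j 1) = v $ j" for j by (simp add: orth inner_axis)
    ultimately show ?thesis
      unfolding m mat_act_def of_coords_orthogonal[OF G2_matricesD(1)[OF g]] fst_conv snd_conv
      by (simp only: matrix_vector_mult_basis[of A])
  qed
  finally show ?thesis .
qed

lemma submodule_of_coords_image: "G2_submodule hat t (of_coords ` C) \<longleftrightarrow> G2_invariant C"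
proof -
  have "subspace (of_coords ` C) \<longleftrightarrow> subspace C"
  proof
    assume "subspace (of_coords ` C)"
    from linear_subspace_vimage[OF linear_of_coords this] show "subspace C"
      by (simp add: inj_vimage_image_eq[OF inj_of_coords])
  qed (rule linear_subspace_image[OF linear_of_coords])
  moreover have "(\<forall>\<gamma>\<in>G2. act_W hat t \<gamma> ` of_coords ` C \<subseteq> of_coords ` C) \<longleftrightarrow> (\<forall>g\<in>G2_matrices. \<forall>m\<in>C. mat_act g m \<in> C)"
  proof -
    have G2: "G2 = G2_of ` G2_matrices" using G2_obtain_matrix G2_of_mem by blast
    show ?thesis
      unfolding G2 by (simp add: act_W_of_coords inj_image_mem_iff[OF inj_of_coords] image_subset_iff del: split_paired_All)
  qed
  ultimately show ?thesis by (simp add: G2_submodule_def G2_invariant_def)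
qed

lemma irreducible_of_coords_image:
  assumes C: "G2_invariant C" "dim C \<noteq> 0"
    and irr: "\<And>S. G2_invariant S \<Longrightarrow> S \<subseteq> C \<Longrightarrow> S \<noteq> {0} \<Longrightarrow> S = C"
  shows "G2_irreducible hat t (of_coords ` C)"
  unfolding G2_irreducible_def
proof (intro conjI allI impI)
  show "G2_submodule hat t (of_coords ` C)" using C by (simp add: submodule_of_coords_image)
  have zero_image: "of_coords ` {0} = {0}" by (simp add: linear_0[OF linear_of_coords])
  show "of_coords ` C \<noteq> {0}"
  proof
    assume "of_coords ` C = {0}"
    then have "C = {0}" using zero_image inj_image_eq_iff[OF inj_of_coords] by metis
    with C show False by simp
  qed
  fix U assume U: "U \<subseteq> of_coords ` C \<and> G2_submodule hat t U"
  obtain S where S: "U = of_coords ` S" "S \<subseteq> C" using U by (meson subset_imageE)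
  have "S = {0} \<or> S = C" using irr U S by (metis submodule_of_coords_image)
  then show "U = {0} \<or> U = of_coords ` C" using S(1) zero_image by auto
qed

text \<open>Every equivariant embedding of \<open>V\<close> has its range in this subspace by \<open>equivariant_in_coords_77\<close>; conversely
  \<open>v \<mapsto> (v, 0)\<close> and \<open>u \<mapsto> (0, X(u))\<close> are two such embeddings whose ranges span it.\<close>

lemma isotypic_of_coords: "isotypic_component_7 hat t = of_coords ` coords_77"
proof
  let ?eq = "\<lambda>T. linear T \<and> inj T \<and> (\<forall>\<gamma>\<in>G2. \<forall>v. T (act_V hat \<gamma> v) = act_W hat t \<gamma> (T v))"
  have sub: "subspace (of_coords ` coords_77)"
    by (intro linear_subspace_image[OF linear_of_coords] G2_invariantD(1)[OF coords_77_invariant])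
  show "isotypic_component_7 hat t \<subseteq> of_coords ` coords_77"
    unfolding isotypic_component_7_def
  proof (rule span_minimal[OF _ sub], rule Union_least, clarify)
    fix T :: "'v \<Rightarrow> 'w" and v
    assume T: "linear T" and eq: "\<forall>\<gamma>\<in>G2. \<forall>v. T (act_V hat \<gamma> v) = act_W hat t \<gamma> (T v)"
    define T' where "T' x = inv of_coords (T (of_im x))" for x
    have T': "of_coords (T' x) = T (of_im x)" for x by (simp add: T'_def surj_f_inv_f[OF surj_of_coords])
    have "linear T'"
      unfolding linear_iff
    proof (intro conjI allI)
      show "T' (x + y) = T' x + T' y" for x y
        by (rule injD[OF inj_of_coords]) (simp add: T' linear_add[OF linear_of_coords] linear_add[OF T] linear_add[OF linear_of_im])
      show "T' (c *\<^sub>R x) = c *\<^sub>R T' x" for c x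
        by (rule injD[OF inj_of_coords]) (simp add: T' linear_scale[OF linear_of_coords] linear_scale[OF T] linear_scale[OF linear_of_im])
    qed
    moreover have "T' (g *v x) = mat_act g (T' x)" if g: "g \<in> G2_matrices" for g x
    proof (rule injD[OF inj_of_coords])
      have "T (act_V hat (G2_of g) (of_im x)) = act_W hat t (G2_of g) (T (of_im x))"
        using eq G2_of_mem[OF g] by blast
      then show "of_coords (T' (g *v x)) = of_coords (mat_act g (T' x))"
        by (simp add: T' act_V_G2_of act_W_of_coords[OF g, symmetric])
    qed
    ultimately have "T' (im v) \<in> coords_77" by (rule equivariant_in_coords_77)
    then show "T v \<in> of_coords ` coords_77" using T'[of "im v"] by (metis image_eqI of_im_im)
  qed
  have embed: "of_coords (f (im v)) \<in> isotypic_component_7 hat t"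
    if f: "linear f" "inj f" "\<And>g x. g \<in> G2_matrices \<Longrightarrow> f (g *v x) = mat_act g (f x)" for f :: "real^7 \<Rightarrow> coords" and v
  proof -
    let ?T = "\<lambda>v. of_coords (f (im v))"
    have "linear ?T"
      using linear_compose[OF linear_compose[OF linear_im f(1)] linear_of_coords] by (simp add: o_def)
    moreover have "inj ?T"
      by (metis (mono_tags, lifting) f(2) inj_of_coords injD injI of_im_im)
    moreover have "?T (act_V hat \<gamma> v) = act_W hat t \<gamma> (?T v)" if "\<gamma> \<in> G2" for \<gamma> v
      using that by (elim G2_obtain_matrix) (simp add: act_V_G2_of act_W_of_coords f(3))
    ultimately show ?thesis
      unfolding isotypic_component_7_def by (intro span_base) blast
  qed
  show "of_coords ` coords_77 \<subseteq> isotypic_component_7 hat t"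
  proof clarify
    fix m assume "m \<in> coords_77"
    then obtain v u where m: "m = (v, 0) + (0, cross_matrix u)" by (auto simp: coords_77_def)
    have "of_coords (im (of_im v), 0) \<in> isotypic_component_7 hat t"
      by (rule embed) (auto simp: linear_iff inj_def mat_act_def)
    moreover have "of_coords (0, cross_matrix (im (of_im u))) \<in> isotypic_component_7 hat t"
      by (rule embed) (auto simp: linear_iff cross_matrix_linear inj_def mat_act_def cross_matrix_equivariant
          dest: injD[OF inj_cross_matrix])
    ultimately show "of_coords m \<in> isotypic_component_7 hat t"
      unfolding m linear_add[OF linear_of_coords] isotypic_component_7_def by (simp add: span_add)
  qed
qed

lemma phi_eq: "phi hat x y z = im_cross (im x) (im y) \<bullet> im z"
proof -
  have "hat x \<cdot> hat y + (x \<bullet> y) *\<^sub>R oone = (0, im_cross (im x) (im y))"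
    by (simp add: hat_eq omult_def oone_def im_inner)
  then have "cross hat x y = of_im (im_cross (im x) (im y))" by (simp add: cross_def inv_hat)
  then show ?thesis unfolding phi_def im_inner[symmetric] by simp
qed

end

section \<open>The summands in an arbitrary orthonormal basis\<close>

lemma conj_inverse:
  fixes F :: "real^'n^'n"
  assumes "orthogonal_matrix F"
  shows "F ** (transpose F ** A ** F) ** transpose F = A" "transpose F ** (F ** A ** transpose F) ** F = A"
proof -
  note o = orthogonalD(1,2)[OF assms]
  have "F ** (transpose F ** A ** F) ** transpose F = (F ** transpose F) ** A ** (F ** transpose F)"
    by (simp only: matrix_mul_assoc)
  then show "F ** (transpose F ** A ** F) ** transpose F = A" by (simp add: o)
  have "transpose F ** (F ** A ** transpose F) ** F = (transpose F ** F) ** A ** (transpose F ** F)"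
    by (simp only: matrix_mul_assoc)
  then show "transpose F ** (F ** A ** transpose F) ** F = A" by (simp add: o)
qed

lemma conj_eq_iff:
  fixes F :: "real^'n^'n"
  assumes "orthogonal_matrix F"
  shows "F ** A ** transpose F = F ** B ** transpose F \<longleftrightarrow> A = B"
  by (metis conj_inverse(2)[OF assms])

lemma conj_nth: "(transpose F ** A ** F) $ i $ j = (F *v axis i 1) \<bullet> (A *v (F *v axis j 1))"
  for F :: "real^'n^'n"
proof -
  have "(transpose F ** A ** F) $ i $ j = axis i 1 \<bullet> ((transpose F ** A ** F) *v axis j 1)"
    by (simp add: matrix_vector_mult_basis column_def inner_axis')
  also have "\<dots> = (F *v axis i 1) \<bullet> (A *v (F *v axis j 1))"
    by (simp only: matrix_vector_mul_assoc[symmetric] transpose_matrix_vector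
        inner_commute[of "axis i 1"] dot_lmul_matrix inner_commute[of "F *v axis i 1"])
  finally show ?thesis .
qed

context octonion_tensor
begin

context
  fixes e :: "7 \<Rightarrow> 'v"
  assumes e: "orthonormal_basis e"
begin

lemma W1_eq: "W1 hat e t = of_coords ` coords_1"
proof -
  have "(\<chi> i j. c * (e i \<bullet> e j)) = c *\<^sub>R mat 1" for c
    using e by (simp add: orthonormal_basis_def vec_eq_iff mat_def)
  moreover have "(\<chi> j. 0) = (0 :: real^7)" by (simp add: vec_eq_iff)
  ultimately show ?thesis
    by (auto simp: W1_def coords_1_def elem_W_eq_of_coords[OF e] orthogonal_conj_mat[OF orthogonal_frame[OF e]])
qed

lemma W7_eq: "W7 hat e t = of_coords ` coords_7"
proof -
  have z: "(\<chi> i j. 0) = (0 :: real^7^7)" by (simp add: vec_eq_iff)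
  have "\<exists>v. u = frame e *v (\<chi> j. v j)" for u
    by (rule exI[of _ "\<lambda>j. (transpose (frame e) *v u) $ j"])
      (simp add: orthogonalD(4)[OF orthogonal_frame[OF e]] del: transpose_matrix_vector)
  then show ?thesis
    by (auto simp: W7_def coords_7_def elem_W_eq_of_coords[OF e] z image_iff) metis
qed

text \<open>The parametrization of the second 7-dimensional summand through \<open>\<phi>\<close> does not depend on the basis,
  because it describes the linear map \<open>x \<mapsto> x \<times> u\<close>.\<close>

lemma cross_matrix_frame:
  "frame e ** (\<chi> i j. \<Sum>k\<in>UNIV. phi hat (e k) (e i) (e j) * u k) ** transpose (frame e)
     = cross_matrix (frame e *v (\<chi> k. u k))" (is "_ ** ?w ** _ = cross_matrix ?U")
proof -
  have "?w $ i $ j = (transpose (frame e) ** cross_matrix ?U ** frame e) $ i $ j" for i j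
  proof -
    have "?w $ i $ j = (\<Sum>k\<in>UNIV. u k * (im_cross (im (e k)) (im (e i)) \<bullet> im (e j)))"
      by (simp add: phi_eq mult.commute)
    also have "\<dots> = (\<Sum>k\<in>UNIV. u k *\<^sub>R im (e k)) \<bullet> im_cross (im (e i)) (im (e j))"
      by (simp add: im_cross_cyclic inner_sum_left)
    also have "\<dots> = im (e i) \<bullet> im_cross (im (e j)) ?U"
      by (metis (no_types, lifting) frame_mult im_cross_cyclic inner_commute sum.cong vec_lambda_beta)
    finally show ?thesis by (simp add: conj_nth frame_axis cross_matrix_mult)
  qed
  then have "?w = transpose (frame e) ** cross_matrix ?U ** frame e" by (simp add: vec_eq_iff)
  then show ?thesis by (simp only: conj_inverse(1)[OF orthogonal_frame[OF e]])
qed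

lemma W7'_eq: "W7' hat e t = of_coords ` coords_7'"
proof -
  have z: "(\<chi> i. 0) = (0 :: real^7)" by (simp add: vec_eq_iff)
  have "\<exists>v. u = frame e *v (\<chi> j. v j)" for u
    by (rule exI[of _ "\<lambda>j. (transpose (frame e) *v u) $ j"])
      (simp add: orthogonalD(4)[OF orthogonal_frame[OF e]] del: transpose_matrix_vector)
  then show ?thesis
    by (auto simp: W7'_def coords_7'_def elem_W_eq_of_coords[OF e] cross_matrix_frame z image_iff) metis
qed

lemma param_eq: "param_7_7 hat e t v u = of_coords (im v, cross_matrix (im u))"
proof -
  have "frame e *v (\<chi> j. v \<bullet> e j) = im v" for v
  proof -
    have "(\<chi> j. v \<bullet> e j) = transpose (frame e) *v im v"
      by (simp add: vec_eq_iff matrix_vector_mult_def transpose_def frame_def im_inner[symmetric] inner_vec_def mult.commute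
        del: transpose_matrix_vector)
    then show ?thesis by (simp add: orthogonalD(4)[OF orthogonal_frame[OF e]] del: transpose_matrix_vector)
  qed
  then show ?thesis
    by (simp add: param_7_7_def elem_W_eq_of_coords[OF e] cross_matrix_frame)
qed

text \<open>The contraction evaluated in the basis \<open>e\<close>; this matches the condition that defines the 14-dimensional
  summand in an arbitrary orthonormal basis.\<close>

lemma contraction_frame:
  "im (e p) \<bullet> contraction (frame e ** (\<chi> i j. w i j) ** transpose (frame e))
     = (\<Sum>i\<in>UNIV. \<Sum>j\<in>UNIV. phi hat (e i) (e j) (e p) * w i j)"
proof -
  let ?F = "frame e" and ?A = "frame e ** (\<chi> i j. w i j) ** transpose (frame e)"
  note F = orthogonal_frame[OF e]
  have lin: "linear (\<lambda>x. im_cross x y)" for y using im_cross_bilinear by (simp add: bilinear_def)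
  have Af: "?A *v (?F *v axis j 1) = (\<Sum>i\<in>UNIV. w i j *\<^sub>R im (e i))" for j
    using frame_mult[of e "\<chi> i. w i j"]
    by (simp add: matrix_vector_mul_assoc[symmetric] orthogonalD(3)[OF F] del: transpose_matrix_vector)
      (simp add: matrix_vector_mult_basis column_def)
  have "bilinear (\<lambda>x y. im_cross (?A *v x) y)"
    using im_cross_bilinear unfolding bilinear_def linear_iff
    by (simp add: matrix_vector_right_distrib matrix_vector_mult_scaleR)
  from orthogonal_sum_bilinear[OF this F]
  have "contraction ?A = (\<Sum>j\<in>UNIV. im_cross (\<Sum>i\<in>UNIV. w i j *\<^sub>R im (e i)) (im (e j)))"
    unfolding Af by (simp add: contraction_alt frame_axis)
  also have "\<dots> = (\<Sum>j\<in>UNIV. \<Sum>i\<in>UNIV. w i j *\<^sub>R im_cross (im (e i)) (im (e j)))"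
    by (simp add: linear_sum[OF lin] linear_scale[OF lin])
  finally show ?thesis
    by (subst sum.swap) (simp add: inner_sum_right phi_eq inner_commute mult.commute)
qed

lemma contraction_frame_eq_0:
  "contraction (frame e ** (\<chi> i j. w i j) ** transpose (frame e)) = 0
     \<longleftrightarrow> (\<forall>p. (\<Sum>i\<in>UNIV. \<Sum>j\<in>UNIV. phi hat (e i) (e j) (e p) * w i j) = 0)" (is "?c = 0 \<longleftrightarrow> _")
proof -
  have "transpose (frame e) *v ?c = (\<chi> p. im (e p) \<bullet> ?c)"
    by (simp add: vec_eq_iff matrix_vector_mult_def transpose_def frame_def inner_vec_def del: transpose_matrix_vector)
  moreover have "?c = 0 \<longleftrightarrow> transpose (frame e) *v ?c = 0"
    by (metis orthogonalD(4)[OF orthogonal_frame[OF e]] matrix_vector_mult_0_right)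
  ultimately show ?thesis by (simp add: contraction_frame[symmetric] vec_eq_iff)
qed

lemma frame_conj_surj: "\<exists>w. A = frame e ** (\<chi> i j. w i j) ** transpose (frame e)"
proof -
  have "A = frame e ** (\<chi> i j. (transpose (frame e) ** A ** frame e) $ i $ j) ** transpose (frame e)"
    by (simp add: conj_inverse(1)[OF orthogonal_frame[OF e]])
  then show ?thesis
    by (rule exI[of _ "\<lambda>i j. (transpose (frame e) ** A ** frame e) $ i $ j"])
qed

lemma elem_W_set_eq:
  "{elem_W hat e t (\<lambda>_. 0) w | w. P (frame e ** (\<chi> i j. w i j) ** transpose (frame e))}
     = of_coords ` {(0, A) | A. P A}" (is "?L = ?R")
proof (intro equalityI subsetI)
  have "(\<chi> i. 0) = (0 :: real^7)" by (simp add: vec_eq_iff)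
  then have el: "elem_W hat e t (\<lambda>_. 0) w = of_coords (0, frame e ** (\<chi> i j. w i j) ** transpose (frame e))" for w
    by (simp add: elem_W_eq_of_coords[OF e])
  show "x \<in> ?R" if "x \<in> ?L" for x using that el by blast
  fix x assume "x \<in> ?R"
  then obtain A where A: "x = of_coords (0, A)" "P A" by blast
  obtain w where w: "A = frame e ** (\<chi> i j. w i j) ** transpose (frame e)"
    using frame_conj_surj by blast
  have "x = elem_W hat e t (\<lambda>_. 0) w" by (simp only: A(1) w el)
  with A(2)[unfolded w] show "x \<in> ?L" by blast
qed

lemma W14_eq: "W14 hat e t = of_coords ` coords_14"
proof -
  have "(\<forall>i j. w j i = - w i j) \<longleftrightarrow> transpose (\<chi> i j. w i j) = - (\<chi> i j. w i j)" for w :: "7 \<Rightarrow> 7 \<Rightarrow> real"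
    by (simp add: transpose_def vec_eq_iff)
  then have sk: "(\<forall>i j. w j i = - w i j) \<longleftrightarrow> transpose (frame e ** (\<chi> i j. w i j) ** transpose (frame e))
      = - (frame e ** (\<chi> i j. w i j) ** transpose (frame e))" for w
    by (simp add: transpose_conj conj_uminus[symmetric] conj_eq_iff[OF orthogonal_frame[OF e]])
  show ?thesis
    unfolding W14_def coords_14_def sk contraction_frame_eq_0[symmetric] by (rule elem_W_set_eq)
qed

lemma W27_eq: "W27 hat e t = of_coords ` coords_27"
proof -
  have "(\<forall>i j. w j i = w i j) \<longleftrightarrow> transpose (\<chi> i j. w i j) = (\<chi> i j. w i j)" for w :: "7 \<Rightarrow> 7 \<Rightarrow> real"
    by (simp add: transpose_def vec_eq_iff)
  then have sy: "(\<forall>i j. w j i = w i j) \<longleftrightarrow> transpose (frame e ** (\<chi> i j. w i j) ** transpose (frame e))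
      = frame e ** (\<chi> i j. w i j) ** transpose (frame e)" for w
    by (simp add: transpose_conj conj_eq_iff[OF orthogonal_frame[OF e]])
  have tr: "(\<Sum>i\<in>UNIV. w i i) = trace (frame e ** (\<chi> i j. w i j) ** transpose (frame e))" for w
    unfolding trace_conj[OF orthogonal_frame[OF e]] by (simp add: trace_def)
  show ?thesis
    unfolding W27_def coords_27_def sy tr by (rule elem_W_set_eq)
qed

end

lemma direct_sum_of_coords_image:
  assumes "direct_sum_decomposition Us"
  shows "direct_sum_decomposition (map ((`) of_coords) Us)"
  unfolding direct_sum_decomposition_def
proof (intro conjI ballI allI)
  show "subspace U" if "U \<in> set (map ((`) of_coords) Us)" for U
    using that assms by (auto simp: direct_sum_decomposition_def intro!: linear_subspace_image[OF linear_of_coords])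
  have sum: "of_coords (sum_list ms) = sum_list (map of_coords ms)" for ms
    by (induction ms) (simp_all add: linear_0[OF linear_of_coords] linear_add[OF linear_of_coords])
  have mem: "list_all2 (\<in>) ws (map ((`) of_coords) Us) \<longleftrightarrow> (\<exists>ms. ws = map of_coords ms \<and> list_all2 (\<in>) ms Us)" for ws
  proof
    assume ws: "list_all2 (\<in>) ws (map ((`) of_coords) Us)"
    have "ws = map of_coords (map (inv of_coords) ws)"
      by (simp add: surj_f_inv_f[OF surj_of_coords] o_def)
    moreover have "list_all2 (\<in>) (map (inv of_coords) ws) Us"
      using ws by (auto simp: list_all2_conv_all_nth inv_f_f[OF inj_of_coords] dest!: spec)
    ultimately show "\<exists>ms. ws = map of_coords ms \<and> list_all2 (\<in>) ms Us" by blast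
  qed (auto simp: list_all2_conv_all_nth)
  fix w
  obtain m where m: "w = of_coords m" using surj_of_coords by blast
  obtain ms where ms: "list_all2 (\<in>) ms Us" "m = sum_list ms"
    and unique: "\<And>ms'. list_all2 (\<in>) ms' Us \<Longrightarrow> m = sum_list ms' \<Longrightarrow> ms' = ms"
    using assms unfolding direct_sum_decomposition_def by metis
  show "\<exists>!ws. list_all2 (\<in>) ws (map ((`) of_coords) Us) \<and> w = sum_list ws"
  proof (rule ex1I[of _ "map of_coords ms"])
    show "list_all2 (\<in>) (map of_coords ms) (map ((`) of_coords) Us) \<and> w = sum_list (map of_coords ms)"
      using ms m by (auto simp: mem sum)
    fix ws assume ws: "list_all2 (\<in>) ws (map ((`) of_coords) Us) \<and> w = sum_list ws"
    then obtain ms' where ms': "ws = map of_coords ms'" "list_all2 (\<in>) ms' Us" using mem by blast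
    have "of_coords m = of_coords (sum_list ms')" using ws ms' m by (simp add: sum)
    then have "m = sum_list ms'" by (rule injD[OF inj_of_coords])
    then show "ws = map of_coords ms" using unique ms' by blast
  qed
qed

lemma dim_of_coords_image: "dim (of_coords ` C) = dim C"
  by (rule dim_image_eq[OF linear_of_coords]) (rule inj_on_subset[OF inj_of_coords subset_UNIV])

end

lemma root_iff: "l * l - l - 8 = 0 \<longleftrightarrow> l = (1 - sqrt 33) / 2 \<or> l = (1 + sqrt 33) / 2"
proof -
  have "sqrt 33 * sqrt 33 = 33" by simp
  then have "l * l - l - 8 = (l - (1 - sqrt 33) / 2) * (l - (1 + sqrt 33) / 2)"
    by (simp add: field_simps)
  then show ?thesis by simp
qed

lemma M77_nth: "M77 $ 1 $ 1 = -1" "M77 $ 1 $ 2 = 6" "M77 $ 2 $ 1 = 1" "M77 $ 2 $ 2 = 2"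
  by (simp_all add: M77_def)

lemma spectrum_M77: "real_spectrum ((*v) M77) = {(1 - sqrt 33) / 2, (1 + sqrt 33) / 2}"
proof -
  have eq: "M77 *v x = l *\<^sub>R x \<longleftrightarrow> x $ 1 = (l - 2) *\<^sub>R (x $ 2) \<and> (l * l - l - 8 = 0 \<or> x $ 2 = 0)" for x l
    using eigen_77_iff[of "x $ 1" "x $ 2" l]
    by (simp add: vec_eq_iff forall_2 matrix_vector_mult_def sum_2 M77_nth)
  have "l \<in> real_spectrum ((*v) M77) \<longleftrightarrow> l * l - l - 8 = 0" for l
  proof
    assume "l \<in> real_spectrum ((*v) M77)"
    then obtain x :: "real^2" where x: "x \<noteq> 0" "M77 *v x = l *\<^sub>R x" by (auto simp: real_spectrum_def)
    have "x $ 2 \<noteq> 0" using x eq by (auto simp: vec_eq_iff forall_2)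
    then show "l * l - l - 8 = 0" using x(2) eq by blast
  next
    assume l: "l * l - l - 8 = 0"
    let ?x = "vector [l - 2, 1] :: real^2"
    have "?x \<noteq> 0" by (auto simp: vec_eq_iff forall_2)
    moreover have "M77 *v ?x = l *\<^sub>R ?x" unfolding eq using l by simp
    ultimately show "l \<in> real_spectrum ((*v) M77)" unfolding real_spectrum_def by blast
  qed
  then show ?thesis by (simp only: set_eq_iff root_iff insert_iff empty_iff simp_thms)
qed

theorem theorem4p3:
  fixes hat :: "'v::euclidean_space \<Rightarrow> octonion"
    and e :: "7 \<Rightarrow> 'v"
    and tens :: "octonion \<Rightarrow> 'v \<Rightarrow> 'w::real_vector"  (infixl "\<otimes>" 75)
    and h :: "'w \<Rightarrow> 'w"
  assumes "DIM('v) = 7"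
    and "isometric_identification hat"
    and "orthonormal_basis e"
    and "is_tensor_product tens"
    and "linear h"
    and "\<And>w :: 7 \<Rightarrow> octonion. h (\<Sum>j\<in>UNIV. w j \<otimes> e j) =
           (\<Sum>i\<in>UNIV. (\<Sum>j\<in>UNIV. (hat (e i) \<cdot> hat (e j)) \<cdot> w j) \<otimes> e i)"
  shows "real_spectrum h = {-7, -4, 0, (1 - sqrt 33) / 2, (1 + sqrt 33) / 2} \<and>
    direct_sum_decomposition
      [W1 hat e tens, W7 hat e tens, W7' hat e tens, W14 hat e tens, W27 hat e tens] \<and>
    G2_irreducible hat tens (W1 hat e tens) \<and>
    G2_irreducible hat tens (W7 hat e tens) \<and> dim (W7 hat e tens) = 7 \<and>
    G2_irreducible hat tens (W7' hat e tens) \<and> dim (W7' hat e tens) = 7 \<and>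
    G2_irreducible hat tens (W14 hat e tens) \<and>
    G2_irreducible hat tens (W27 hat e tens) \<and>
    eigenspace h (-7) = W1 hat e tens \<and> dim (eigenspace h (-7)) = 1 \<and>
    eigenspace h (-4) = W14 hat e tens \<and> dim (eigenspace h (-4)) = 14 \<and>
    eigenspace h 0 = W27 hat e tens \<and> dim (eigenspace h 0) = 27 \<and>
    inj (\<lambda>(v, u). param_7_7 hat e tens v u) \<and>
    range (\<lambda>(v, u). param_7_7 hat e tens v u) = isotypic_component_7 hat tens \<and>
    (\<forall>v u. h (param_7_7 hat e tens v u) =
       param_7_7 hat e tens (M77 $ 1 $ 1 *\<^sub>R v + M77 $ 1 $ 2 *\<^sub>R u)
                            (M77 $ 2 $ 1 *\<^sub>R v + M77 $ 2 $ 2 *\<^sub>R u)) \<and>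
    real_spectrum h - {-7, -4, 0} = real_spectrum ((*v) M77) \<and>
    real_spectrum ((*v) M77) = {(1 - sqrt 33) / 2, (1 + sqrt 33) / 2} \<and>
    (\<forall>c \<in> real_spectrum ((*v) M77).
       eigenspace h c \<subseteq> isotypic_component_7 hat tens \<and> dim (eigenspace h c) = 7)"
proof -
  interpret octonion_tensor hat tens using assms by unfold_locales
  note e = \<open>orthonormal_basis e\<close>
  note W = W1_eq[OF e] W7_eq[OF e] W7'_eq[OF e] W14_eq[OF e] W27_eq[OF e]
  have h: "h (of_coords m) = of_coords (h_coords m)" for m
    using h_of_coords[OF e] assms(6) by blast
  have eigen: "eigenspace h l = of_coords ` eigenspace h_coords l" for l
  proof -
    have "of_coords m \<in> eigenspace h l \<longleftrightarrow> m \<in> eigenspace h_coords l" for m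
      by (simp add: eigenspace_def h linear_scale[OF linear_of_coords, symmetric] inj_eq[OF inj_of_coords])
    then have "of_coords -` eigenspace h l = eigenspace h_coords l" by blast
    then show ?thesis using surj_image_vimage_eq[OF surj_of_coords, of "eigenspace h l"] by simp
  qed
  have root7: "eigenspace h l \<subseteq> isotypic_component_7 hat tens \<and> dim (eigenspace h l) = 7"
    if "l * l - l - 8 = 0" for l
    using that by (auto simp: eigen eigenspace_h_coords(4) dim_of_coords_image dim_small isotypic_of_coords intro!: imageI coords_77I)
  have spec: "l \<in> real_spectrum h \<longleftrightarrow> \<not> eigenspace h l \<subseteq> {0}" for l
    by (auto simp: real_spectrum_def eigenspace_def)
  have dim_pos: "l \<in> real_spectrum h" if "dim (eigenspace h l) \<noteq> 0" for l
  proof -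
    have "dim (eigenspace h_coords l) \<noteq> 0" using that by (simp only: eigen dim_of_coords_image not_False_eq_True)
    then obtain m where m: "m \<in> eigenspace h_coords l" "m \<noteq> 0" unfolding dim_eq_0 by blast
    then have "of_coords m \<in> eigenspace h l" by (simp only: eigen imageI)
    moreover have "of_coords m \<noteq> 0" using m(2) inj_eq[OF inj_of_coords, of m 0] by (simp add: linear_0[OF linear_of_coords])
    ultimately show ?thesis unfolding spec by blast
  qed
  have dims: "dim (eigenspace h (-7)) = 1" "dim (eigenspace h (-4)) = 14" "dim (eigenspace h 0) = 27"
    by (simp_all add: eigen eigenspace_h_coords dim_of_coords_image dim_small dim_large)
  have roots: "(1 - sqrt 33) / 2 * ((1 - sqrt 33) / 2) - (1 - sqrt 33) / 2 - 8 = 0"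
     "(1 + sqrt 33) / 2 * ((1 + sqrt 33) / 2) - (1 + sqrt 33) / 2 - 8 = 0"
    by (simp_all only: root_iff simp_thms)
  have spectrum: "real_spectrum h = {-7, -4, 0, (1 - sqrt 33) / 2, (1 + sqrt 33) / 2}"
  proof (intro subset_antisym subsetI)
    fix l assume "l \<in> {-7, -4, 0, (1 - sqrt 33) / 2, (1 + sqrt 33) / 2}"
    then consider "l = -7" | "l = -4" | "l = 0" | "l * l - l - 8 = 0" using root_iff by blast
    then have "dim (eigenspace h l) \<noteq> 0" using dims root7 by cases auto
    then show "l \<in> real_spectrum h" by (rule dim_pos)
  next
    fix l assume "l \<in> real_spectrum h"
    then have "\<not> of_coords ` eigenspace h_coords l \<subseteq> {0}" by (simp only: spec eigen not_False_eq_True)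
    moreover have "of_coords ` {0} \<subseteq> {0}" by (simp add: linear_0[OF linear_of_coords])
    ultimately have "eigenspace h_coords l \<noteq> {0}" by metis
    then show "l \<in> {-7, -4, 0, (1 - sqrt 33) / 2, (1 + sqrt 33) / 2}"
      using eigenspace_h_coords(5)[of l] root_iff[of l] by blast
  qed
  have "direct_sum_decomposition
      [W1 hat e tens, W7 hat e tens, W7' hat e tens, W14 hat e tens, W27 hat e tens]"
    using direct_sum_of_coords_image[OF coords_direct_sum] by (simp add: W)
  moreover have "G2_irreducible hat tens (W1 hat e tens)" "G2_irreducible hat tens (W7 hat e tens)"
    "G2_irreducible hat tens (W7' hat e tens)" "G2_irreducible hat tens (W14 hat e tens)"
    "G2_irreducible hat tens (W27 hat e tens)"
    unfolding W
    by (intro irreducible_of_coords_image coords_submodules coords_1_irreducible coords_7_irreducible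
        coords_7'_irreducible coords_14_irreducible coords_27_irreducible; simp add: dim_small dim_large del: dim_eq_0)+
  moreover have "dim (W7 hat e tens) = 7" "dim (W7' hat e tens) = 7"
    by (simp_all add: W dim_of_coords_image dim_small)
  moreover have "eigenspace h (-7) = W1 hat e tens" "eigenspace h (-4) = W14 hat e tens" "eigenspace h 0 = W27 hat e tens"
    by (simp_all add: W eigen eigenspace_h_coords)
  moreover have "inj (\<lambda>(v, u). param_7_7 hat e tens v u)"
    by (auto simp: inj_def param_eq[OF e] inj_eq[OF inj_of_coords] inj_eq[OF inj_cross_matrix])
      (metis of_im_im)+
  moreover have "range (\<lambda>(v, u). param_7_7 hat e tens v u) = isotypic_component_7 hat tens"
  proof -
    have "range (\<lambda>(v, u). param_7_7 hat e tens v u) = of_coords ` range (\<lambda>(v, u). (im v, cross_matrix (im u)))"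
      by (auto simp: param_eq[OF e])
    also have "range (\<lambda>(v, u). (im v, cross_matrix (im u))) = coords_77"
    proof (intro equalityI subsetI)
      show "m \<in> coords_77" if "m \<in> range (\<lambda>(v, u). (im v, cross_matrix (im u)))" for m
        using that by (auto intro: coords_77I)
      fix m assume "m \<in> coords_77"
      then obtain v u where "m = (v, cross_matrix u)" by (auto simp: coords_77_def)
      then show "m \<in> range (\<lambda>(v, u). (im v, cross_matrix (im u)))"
        by (intro image_eqI[of _ _ "(of_im v, of_im u)"]) simp_all
    qed
    finally show ?thesis by (simp add: isotypic_of_coords)
  qed
  moreover have "h (param_7_7 hat e tens v u) =
       param_7_7 hat e tens (M77 $ 1 $ 1 *\<^sub>R v + M77 $ 1 $ 2 *\<^sub>R u)
                            (M77 $ 2 $ 1 *\<^sub>R v + M77 $ 2 $ 2 *\<^sub>R u)" for v u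
  proof -
    have "h_coords (im v, cross_matrix (im u)) = (- im v + 6 *\<^sub>R im u, cross_matrix (im v + 2 *\<^sub>R im u))"
      using h_coords_assemble[OF is_14_27_0, of 0 "im v" "im u"] by (simp add: assemble_def)
    then show ?thesis
      by (simp add: param_eq[OF e] h M77_nth linear_add[OF linear_im] linear_scale[OF linear_im] linear_diff[OF linear_im])
  qed
  moreover have "real_spectrum h - {-7, -4, 0} = real_spectrum ((*v) M77)"
  proof -
    have "l \<notin> {-7, -4, 0}" if "l * l - l - 8 = 0" for l :: real using that by auto
    note this[OF roots(1)] this[OF roots(2)]
    moreover have "{a, b, c, x, y} - {a, b, c} = {x, y}" if "x \<notin> {a, b, c}" "y \<notin> {a, b, c}" for a b c x y :: real
      using that by auto
    ultimately show ?thesis unfolding spectrum spectrum_M77 by presburger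
  qed
  moreover have "\<forall>c \<in> real_spectrum ((*v) M77).
       eigenspace h c \<subseteq> isotypic_component_7 hat tens \<and> dim (eigenspace h c) = 7"
    using root7 root_iff unfolding spectrum_M77 by blast
  ultimately show ?thesis using spectrum dims spectrum_M77 by blast
qed

end
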